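(* Let $m\ge 3$ and let $\Omega\subset\mathbb{S}^m$ be an open domain with $\partial\Omega=\mathcal{V}_1\cup\mathcal{V}_2$, where $\mathcal{V}_1,\mathcal{V}_2$ are disjoint compact submanifolds of $\mathbb{S}^m$ (possibly of dimension zero, and $\mathcal V_2$ possibly empty). Let $\rho\in C^{2,\alpha}(\Omega\cup\mathcal{V}_1)$ and $\sigma=e^{-\rho}$, and assume: (1) $\sigma^2$ extends to a $C^{1,1}$ function on $\overline{\Omega}$; (2) $|\nabla\sigma|^2$ extends to a Lipschitz function on $\overline{\Omega}$. Then there is $t_0>0$ such that for all $t>t_0$ the map $\phi_t:=\phi^{\rho+t}:\Omega\cup\mathcal{V}_1\to\mathbb{H}^{m+1}$ associated to $\rho_t=\rho+t$ is an embedded (injective) horospherically concave hypersurface.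
   Context: $\mathbb{S}^m\subset\mathbb{R}^{m+1}$ is the unit sphere with round metric $g_0$; $\nabla$, $\nabla^2$, $|\cdot|$ are with respect to $g_0$. Let $\mathbb{L}^{m+2}$ be $\mathbb{R}^{m+2}$ with $\langle\!\langle x,y\rangle\!\rangle=-x_0y_0+\sum_{i=1}^{m+1}x_iy_i$, and $\mathbb{H}^{m+1}=\{x:\langle\!\langle x,x\rangle\!\rangle=-1,\ x_0>0\}$. For $\rho\in C^1$ the associated map is $$\phi^\rho(x)=\frac{e^{\rho(x)}}{2}\Big(1+e^{-2\rho(x)}\big(1+|\nabla\rho(x)|^2\big)\Big)(1,x)+e^{-\rho(x)}\big(0,-x+\nabla\rho(x)\big).$$ For a conformal metric $g=e^{2\rho}g_0$ ($m\ge3$), the Schouten tensor is $\mathrm{Sch}(g)=\frac{1}{m-2}\big(\mathrm{Ric}(g)-\frac{R(g)}{2(m-1)}g\big)$; its eigenvalues $\lambda_1,\dots,\lambda_m$ are those of $g^{-1}\mathrm{Sch}(g)$. On the sphere, $\mathrm{Sch}(g)=\tfrac12 g_0-\nabla^2\rho+d\rho\otimes d\rho-\tfrac12|\nabla\rho|^2g_0$. The map $\phi^\rho$ ($\rho\in C^2$) is called a horospherically concave hypersurface when all eigenvalues of the Schouten tensor of $e^{2\rho}g_0$ are $<1/2$; then $\phi^\rho$ is an immersion with unit normal $\eta=\phi^\rho-e^{\rho}(1,x)$ whose principal curvatures $\kappa_i>-1$ satisfy $\lambda_i=\tfrac12-\tfrac1{1+\kappa_i}$. *)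

theory Defs
  imports "HOL-Analysis.Analysis"
begin

text \<open>The ambient space R^(m+1) is an abstract euclidean space 'a with DIM('a) = m+1;
  the unit sphere S^m is sphere 0 1.  Functions on (subsets of) the sphere are
  differentiated through their 0-homogeneous extension to the cone over their domain.\<close>

definition hext :: "('a::euclidean_space \<Rightarrow> real) \<Rightarrow> 'a \<Rightarrow> real" where
  "hext f y = f (y /\<^sub>R norm y)"

definition scone :: "'a::euclidean_space set \<Rightarrow> 'a set" where
  "scone A = {y. y \<noteq> 0 \<and> y /\<^sub>R norm y \<in> A}"

definition sgrad :: "('a::euclidean_space \<Rightarrow> real) \<Rightarrow> 'a set \<Rightarrow> 'a \<Rightarrow> 'a" where
  "sgrad f A x = (\<Sum>b\<in>Basis. frechet_derivative (hext f) (at x within scone A) b *\<^sub>R b)"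

text \<open>Spherical (covariant) Hessian of f on A at x, evaluated on tangent vectors u v;
  for a 0-homogeneous extension it coincides with the Euclidean second derivative.\<close>
definition shess :: "('a::euclidean_space \<Rightarrow> real) \<Rightarrow> 'a set \<Rightarrow> 'a \<Rightarrow> 'a \<Rightarrow> 'a \<Rightarrow> real" where
  "shess f A x u v = frechet_derivative
      (\<lambda>y. frechet_derivative (hext f) (at y within scone A) u) (at x within scone A) v"

text \<open>Schouten tensor of e^(2f) g_0 on the sphere:
  Sch = 1/2 g_0 - Hess f + df (x) df - 1/2 |grad f|^2 g_0.\<close>
definition schouten :: "('a::euclidean_space \<Rightarrow> real) \<Rightarrow> 'a set \<Rightarrow> 'a \<Rightarrow> 'a \<Rightarrow> 'a \<Rightarrow> real" where
  "schouten f A x u v = (1/2) * (u \<bullet> v) - shess f A x u v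
      + (sgrad f A x \<bullet> u) * (sgrad f A x \<bullet> v) - (1/2) * (norm (sgrad f A x))\<^sup>2 * (u \<bullet> v)"

text \<open>Eigenvalues of g^(-1) Sch(g) on T_x S^m = {u. u \<bullet> x = 0}, with g = e^(2f) g_0.\<close>
definition schouten_eigenvalues :: "('a::euclidean_space \<Rightarrow> real) \<Rightarrow> 'a set \<Rightarrow> 'a \<Rightarrow> real set" where
  "schouten_eigenvalues f A x = {lam. \<exists>u. u \<bullet> x = 0 \<and> u \<noteq> 0 \<and>
      (\<forall>v. v \<bullet> x = 0 \<longrightarrow> schouten f A x u v = lam * (exp (2 * f x) * (u \<bullet> v)))}"

definition horo_concave :: "('a::euclidean_space \<Rightarrow> real) \<Rightarrow> 'a set \<Rightarrow> bool" where
  "horo_concave f A \<longleftrightarrow> (\<forall>x\<in>A. \<forall>lam\<in>schouten_eigenvalues f A x. lam < 1/2)"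

definition hyperbolic_space :: "(real \<times> 'a::euclidean_space) set" where
  "hyperbolic_space = {(x0, y). - x0\<^sup>2 + y \<bullet> y = -1 \<and> x0 > 0}"

definition phi :: "('a::euclidean_space \<Rightarrow> real) \<Rightarrow> 'a set \<Rightarrow> 'a \<Rightarrow> real \<times> 'a" where
  "phi f A x = (let c = exp (f x) / 2 * (1 + exp (- 2 * f x) * (1 + (norm (sgrad f A x))\<^sup>2))
               in (c, c *\<^sub>R x + exp (- f x) *\<^sub>R (sgrad f A x - x)))"

fun ck_on :: "nat \<Rightarrow> 'a::real_normed_vector set \<Rightarrow> ('a \<Rightarrow> 'b::real_normed_vector) \<Rightarrow> bool" where
  "ck_on 0 U f = continuous_on U f"
| "ck_on (Suc k) U f = (\<exists>f'. (\<forall>x\<in>U. (f has_derivative f' x) (at x)) \<and>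
                              (\<forall>v. ck_on k U (\<lambda>x. f' x v)))"

definition smooth_on :: "'a::real_normed_vector set \<Rightarrow> ('a \<Rightarrow> 'b::real_normed_vector) \<Rightarrow> bool" where
  "smooth_on U f \<longleftrightarrow> (\<forall>k. ck_on k U f)"

definition emb_submanifold :: "'a::euclidean_space set \<Rightarrow> bool" where
  "emb_submanifold V \<longleftrightarrow> (\<forall>x\<in>V. \<exists>U (\<psi>::'a \<Rightarrow> 'a) L. open U \<and> x \<in> U \<and> subspace L \<and>
      smooth_on U \<psi> \<and> inj_on \<psi> U \<and> open (\<psi> ` U) \<and>
      smooth_on (\<psi> ` U) (inv_into U \<psi>) \<and> \<psi> ` (U \<inter> V) = \<psi> ` U \<inter> L)"

definition compact_submanifold_of_sphere :: "'a::euclidean_space set \<Rightarrow> bool" where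
  "compact_submanifold_of_sphere V \<longleftrightarrow> compact V \<and> V \<subseteq> sphere 0 1 \<and> emb_submanifold V"

text \<open>rho \<in> C^(2,alpha)(A) for A \<subseteq> S^m, locally up to the boundary: near each point of A the
  homogeneous extension of rho agrees (on the cone over A) with a C^2 function whose second
  derivative is alpha-Hoelder.\<close>
definition c2alpha_on :: "real \<Rightarrow> 'a::euclidean_space set \<Rightarrow> ('a \<Rightarrow> real) \<Rightarrow> bool" where
  "c2alpha_on \<alpha> A f \<longleftrightarrow> (\<forall>x\<in>A. \<exists>r>0. \<exists>g g1 g2.
      (\<forall>y\<in>ball x r. (g has_derivative g1 y) (at y)) \<and>
      (\<forall>y\<in>ball x r. \<forall>u. ((\<lambda>z. g1 z u) has_derivative g2 y u) (at y)) \<and>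
      (\<exists>C. \<forall>y\<in>ball x r. \<forall>z\<in>ball x r. \<forall>u v.
          \<bar>g2 y u v - g2 z u v\<bar> \<le> C * norm u * norm v * dist y z powr \<alpha>) \<and>
      (\<forall>y\<in>ball x r \<inter> scone A. g y = hext f y))"

text \<open>f (defined on the open set \<Omega> \<subseteq> S^m) extends to a C^(1,1) function on the closure of \<Omega>
  (Gilbarg-Trudinger convention: f and its gradient extend continuously to the closure and
  the gradient is Lipschitz on \<Omega>).\<close>
definition c11_closure :: "'a::euclidean_space set \<Rightarrow> ('a \<Rightarrow> real) \<Rightarrow> bool" where
  "c11_closure \<Omega> f \<longleftrightarrow>
     (\<exists>F. continuous_on (closure \<Omega>) F \<and> (\<forall>x\<in>\<Omega>. F x = f x)) \<and>
     (\<exists>G. continuous_on (closure \<Omega>) G \<and> (\<forall>x\<in>\<Omega>. G x = sgrad f \<Omega> x)) \<and>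
     (\<exists>L. L-lipschitz_on \<Omega> (sgrad f \<Omega>))"

end

theory Submission
  imports Defs
begin

text \<open>
  Write \<open>\<sigma> = exp (- \<rho>)\<close>, \<open>Q = \<sigma>\<^sup>2 + |\<nabla>\<sigma>|\<^sup>2\<close> and \<open>W = (Q - 2 \<sigma>\<^sup>2) x - \<nabla>(\<sigma>\<^sup>2)\<close>. With
  \<open>\<epsilon> = exp (- 2 t)\<close>, the map \<open>\<phi>\<^sub>t\<close> is a multiple of \<open>(1 + \<epsilon> Q, x + \<epsilon> W)\<close>, so in the projective
  model of hyperbolic space it is an \<open>\<epsilon>\<close>-small Lipschitz perturbation of the identity and hence
  injective for large \<open>t\<close>. Similarly \<open>\<sigma>\<^sup>2 Sch \<le> (\<nabla>\<^sup>2(\<sigma>\<^sup>2) + \<sigma>\<^sup>2 g\<^sub>0) / 2\<close>, which is bounded because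
  \<open>\<nabla>(\<sigma>\<^sup>2)\<close> is Lipschitz, whereas the metric grows like \<open>exp (2 t)\<close>.

  Two points rest on the boundary being a submanifold: the derivative within the domain is unique
  at boundary points, and a function on \<open>\<Omega>\<close> with bounded gradient and a continuous extension to
  the closure is Lipschitz. Both follow from the existence, near each boundary point, of a direction
  \<open>w\<close> such that lines in directions close to \<open>w\<close> cross the boundary at most once.
\<close>

text \<open>Since \<rho> may tend to infinity at \<open>V2\<close>, no estimate can be made for
  \<rho> itself; everything is phrased through \<open>s\<close> (that is, sigma squared) and
  \<open>s *\<^sub>R Gr\<close>, and the multiplier \<open>2 * exp (- (\<rho> x + t))\<close> is
  exactly what turns \<open>phi\<close> into such quantities. The boundary may have any positive
  codimension in the sphere, and \<Omega> may lie on both sides of it (a slit). Nearby points of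
  \<Omega> then need not be joined by a short path inside \<Omega>, so a bounded gradient alone
  gives no Lipschitz bound. A path is allowed to cross the boundary at isolated points, and the
  continuous extension carries the estimate over them. Derivatives live on the open cone over
  \<Omega>, so the boundary has to be understood as a cone too: its tangent space gains the radial
  direction. A transversal direction still exists because a boundary chart has
  \<open>dim L + 2 \<le> DIM('a)\<close>. That inequality is not part of
  \<open>emb_submanifold\<close>; invariance of domain supplies it.\<close>

section \<open>Submanifolds in the frontier of a spherical domain\<close>

text \<open>Strict differentiability: the error is controlled for pairs of points near
  \<open>x\<close>, not only against \<open>x\<close> itself. Secants of a submanifold, rather than
  its tangent vectors, can then be compared with the flat model.\<close>

lemma ck_on_1_strict_derivative:
  fixes f :: "'a::euclidean_space \<Rightarrow> 'b::real_normed_vector"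
  assumes "open U" "x \<in> U" "ck_on (Suc 0) U f"
  obtains D where "bounded_linear D"
    and "\<And>e. e > 0 \<Longrightarrow> \<exists>d>0. \<forall>p\<in>ball x d. \<forall>q\<in>ball x d.
           norm (f p - f q - D (p - q)) \<le> e * norm (p - q)"
proof -
  obtain f' where f': "\<And>y. y \<in> U \<Longrightarrow> (f has_derivative f' y) (at y)"
    and cont: "\<And>v. continuous_on U (\<lambda>y. f' y v)"
    using assms(3) by auto
  have bl: "bounded_linear (f' y)" if "y \<in> U" for y
    using f'[OF that] by (rule has_derivative_bounded_linear)
  have "\<exists>d>0. \<forall>p\<in>ball x d. \<forall>q\<in>ball x d. norm (f p - f q - f' x (p - q)) \<le> e * norm (p - q)"
    if "e > 0" for e :: real
  proof -
    \<comment> \<open>\<open>ck_on\<close> gives continuity of \<open>f' y v\<close> only for each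
      fixed \<open>v\<close>. A tolerance of \<open>e / N\<close> on each of the \<open>N\<close>
      basis vectors adds up to \<open>e\<close> in operator norm.\<close>
    define N where "N = real DIM('a)"
    have "N > 0" by (simp add: N_def)
    have "\<forall>\<^sub>F y in at x. norm (f' y b - f' x b) < e / N" for b
    proof -
      have "((\<lambda>y. f' y b) \<longlongrightarrow> f' x b) (at x)"
        using cont[of b] assms(1,2) by (simp add: continuous_on_eq_continuous_at isCont_def)
      then show ?thesis
        using \<open>e > 0\<close> \<open>N > 0\<close> by (auto simp: tendsto_iff dist_norm)
    qed
    then have "\<forall>\<^sub>F y in at x. \<forall>b\<in>Basis. norm (f' y b - f' x b) < e / N"
      by (intro eventually_ball_finite) auto
    moreover have "\<forall>\<^sub>F y in at x. y \<in> U"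
      using assms by (simp add: eventually_at_topological) blast
    ultimately have "\<forall>\<^sub>F y in at x. (\<forall>b\<in>Basis. norm (f' y b - f' x b) < e / N) \<and> y \<in> U"
      by eventually_elim blast
    then obtain d where d: "d > 0"
      and "\<And>y. y \<noteq> x \<Longrightarrow> dist y x < d \<Longrightarrow> (\<forall>b\<in>Basis. norm (f' y b - f' x b) < e / N) \<and> y \<in> U"
      unfolding eventually_at by blast
    then have dd: "y \<in> U" "\<And>b. b \<in> Basis \<Longrightarrow> norm (f' y b - f' x b) \<le> e / N" if "y \<in> ball x d" for y
      using that assms(2) \<open>e > 0\<close> \<open>N > 0\<close>
      by (cases "y = x"; force simp: dist_commute less_imp_le)+
    have on: "onorm (\<lambda>v. f' y v - f' x v) \<le> e" if y: "y \<in> ball x d" for y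
    proof (rule onorm_bound)
      fix v
      interpret Y: bounded_linear "f' y" using bl dd(1)[OF y] by blast
      interpret X: bounded_linear "f' x" using bl assms(2) by blast
      have "f' y v - f' x v = (\<Sum>b\<in>Basis. (v \<bullet> b) *\<^sub>R (f' y b - f' x b))"
      proof -
        have "f' y v - f' x v = f' y (\<Sum>b\<in>Basis. (v \<bullet> b) *\<^sub>R b) - f' x (\<Sum>b\<in>Basis. (v \<bullet> b) *\<^sub>R b)"
          by (simp add: euclidean_representation)
        also have "\<dots> = (\<Sum>b\<in>Basis. (v \<bullet> b) *\<^sub>R (f' y b - f' x b))"
          by (simp add: Y.sum X.sum Y.scaleR X.scaleR scaleR_diff_right sum_subtractf)
        finally show ?thesis .
      qed
      also have "norm \<dots> \<le> (\<Sum>b\<in>(Basis::'a set). norm v * (e / N))"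
        by (rule sum_norm_le) (unfold norm_scaleR, intro mult_mono dd(2)[OF y] Basis_le_norm, auto)
      also have "\<dots> = e * norm v" using \<open>N > 0\<close> by (simp add: N_def)
      finally show "norm (f' y v - f' x v) \<le> e * norm v" .
    qed (use \<open>e > 0\<close> in simp)
    have "norm (f p - f q - f' x (p - q)) \<le> e * norm (p - q)"
      if pq: "p \<in> ball x d" "q \<in> ball x d" for p q
    proof -
      interpret X: bounded_linear "f' x" using bl assms(2) by blast
      \<comment> \<open>Mean value inequality on the ball for \<open>f\<close> minus its
        linearisation at \<open>x\<close>, whose derivative has norm at most
        \<open>e\<close>.\<close>
      have "((\<lambda>y. f y - f' x y) has_derivative (\<lambda>v. f' y v - f' x v)) (at y within ball x d)"
        if "y \<in> ball x d" for y
        by (rule has_derivative_diff[OF has_derivative_at_withinI[OF f'[OF dd(1)[OF that]]]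
              X.has_derivative[OF has_derivative_ident]])
      then have "norm ((f p - f' x p) - (f q - f' x q)) \<le> e * norm (p - q)"
        by (rule differentiable_bound[OF convex_ball _ on pq])
      then show ?thesis by (simp add: X.diff algebra_simps)
    qed
    with d show ?thesis by blast
  qed
  then show ?thesis using that[of "f' x"] bl assms(2) by blast
qed

text \<open>The vector splits as \<open>p - q\<close> plus a multiple of \<open>q\<close> of length
  \<open>\<bar>norm q - norm p\<bar>\<close>; each part is at most \<open>norm (p - q)\<close>,
  hence the factor 2.\<close>

lemma norm_sgn_diff_le:
  fixes p q :: "'a::real_normed_vector"
  assumes "p \<noteq> 0" "q \<noteq> 0"
  shows "norm p * norm (p /\<^sub>R norm p - q /\<^sub>R norm q) \<le> 2 * norm (p - q)"
proof -
  have eq: "norm p *\<^sub>R (p /\<^sub>R norm p - q /\<^sub>R norm q) = (p - q) + (1 - norm p / norm q) *\<^sub>R q"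
    using assms by (simp add: algebra_simps divide_inverse)
  have "norm ((1 - norm p / norm q) *\<^sub>R q) = \<bar>norm q - norm p\<bar>"
  proof -
    have "\<bar>1 - norm p / norm q\<bar> * norm q = \<bar>(1 - norm p / norm q) * norm q\<bar>"
      by (simp add: abs_mult)
    also have "(1 - norm p / norm q) * norm q = norm q - norm p"
      using assms by (simp add: field_simps)
    finally show ?thesis by simp
  qed
  also have "\<dots> \<le> norm (p - q)" by (metis abs_minus_commute norm_triangle_ineq3)
  finally have "norm (norm p *\<^sub>R (p /\<^sub>R norm p - q /\<^sub>R norm q)) \<le> norm (p - q) + norm (p - q)"
    unfolding eq by (meson add_left_mono norm_triangle_ineq order_trans)
  then show ?thesis by simp
qed

lemma subspace_dim_less_ortho:
  fixes S :: "'a::euclidean_space set"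
  assumes "dim S < DIM('a)"
  obtains w where "norm w = 1" "\<And>s. s \<in> S \<Longrightarrow> s \<bullet> w = 0"
proof -
  obtain v where v: "v \<noteq> 0" "\<And>y. y \<in> span S \<Longrightarrow> orthogonal v y"
    using orthogonal_to_subspace_exists[OF assms] by blast
  show ?thesis
    by (rule that[of "v /\<^sub>R norm v"])
       (use v span_base in \<open>auto simp: orthogonal_def inner_commute\<close>)
qed

section \<open>Cones over subsets of the sphere\<close>

lemma scone_scaleR:
  assumes "c > 0" shows "c *\<^sub>R y \<in> scone A \<longleftrightarrow> y \<in> scone A"
  using assms by (simp add: scone_def sgn_scaleR flip: sgn_div_norm)

lemma hext_scaleR:
  assumes "c > 0" shows "hext f (c *\<^sub>R y) = hext f y"
proof -
  have "(c *\<^sub>R y) /\<^sub>R norm (c *\<^sub>R y) = y /\<^sub>R norm y"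
    using sgn_scaleR[of c y] assms by (simp only: sgn_div_norm) simp
  then show ?thesis by (simp only: hext_def)
qed

lemma sphere_subset_scone: "A \<subseteq> sphere 0 1 \<Longrightarrow> A \<subseteq> scone A"
  by (auto simp: scone_def)

lemma open_scone:
  fixes \<Omega> :: "'a::euclidean_space set"
  assumes "openin (top_of_set (sphere 0 1)) \<Omega>"
  shows "open (scone \<Omega>)"
proof -
  obtain T where T: "open T" "\<Omega> = sphere 0 1 \<inter> T"
    using assms by (auto simp: openin_open)
  have "scone \<Omega> = (\<lambda>y. y /\<^sub>R norm y) -` T \<inter> (- {0})"
    by (auto simp: scone_def T)
  moreover have "open ((\<lambda>y::'a. y /\<^sub>R norm y) -` T \<inter> (- {0}))"
    by (subst Int_commute, rule continuous_open_preimage) (auto intro!: continuous_intros T)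
  ultimately show ?thesis by simp
qed

text \<open>The cone over \<open>V\<close> has tangent space spanned by \<open>x\<close> and
  \<open>D\<close> applied to \<open>L\<close>, which is a proper subspace; any unit normal
  \<open>w\<close> to it works. Strict differentiability makes the secants near \<open>x\<close>
  almost orthogonal to \<open>w\<close>.\<close>

lemma submanifold_transversal:
  fixes V :: "'a::euclidean_space set" and \<psi> :: "'a \<Rightarrow> 'a"
  assumes sub: "V \<subseteq> sphere 0 1" and x: "x \<in> V"
    and U: "open U" "x \<in> U" and L: "subspace L" and dim: "dim L + 2 \<le> DIM('a)"
    and psi: "smooth_on U \<psi>" "inj_on \<psi> U" "open (\<psi> ` U)" "smooth_on (\<psi> ` U) (inv_into U \<psi>)"
    and flat: "\<psi> ` (U \<inter> V) = \<psi> ` U \<inter> L"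
  obtains w r where "norm w = 1" "r > 0"
    "\<And>p q. p \<in> scone V \<inter> ball x r \<Longrightarrow> q \<in> scone V \<inter> ball x r \<Longrightarrow> \<bar>(p - q) \<bullet> w\<bar> \<le> norm (p - q) / 2"
proof -
  define \<phi> where "\<phi> = inv_into U \<psi>"
  have "norm x = 1" "x \<noteq> 0" using sub x by auto
  have "ck_on (Suc 0) U \<psi>" "ck_on (Suc 0) (\<psi> ` U) \<phi>"
    using psi unfolding smooth_on_def \<phi>_def by blast+
  from ck_on_1_strict_derivative[OF U this(1)] obtain E where E: "bounded_linear E"
    "\<And>e. e > 0 \<Longrightarrow> \<exists>d>0. \<forall>p\<in>ball x d. \<forall>q\<in>ball x d. norm (\<psi> p - \<psi> q - E (p - q)) \<le> e * norm (p - q)"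
    by blast
  from ck_on_1_strict_derivative[OF psi(3) imageI[OF U(2), of \<psi>] \<open>ck_on (Suc 0) (\<psi> ` U) \<phi>\<close>]
  obtain D where D: "bounded_linear D"
    "\<And>e. e > 0 \<Longrightarrow> \<exists>d>0. \<forall>p\<in>ball (\<psi> x) d. \<forall>q\<in>ball (\<psi> x) d. norm (\<phi> p - \<phi> q - D (p - q)) \<le> e * norm (p - q)"
    by blast
  interpret E: bounded_linear E by (rule E)
  interpret D: bounded_linear D by (rule D)
  \<comment> \<open>Including \<open>x\<close> makes \<open>w\<close> orthogonal to the radial
    direction as well, which is needed for secants of the cone between points of different
    norm.\<close>
  have "dim (insert x (D ` L)) \<le> dim (D ` L) + 1" by (simp add: dim_insert)
  also have "\<dots> < DIM('a)" using dim dim_image_le[OF D.linear, of L] by linarith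
  finally obtain w where w: "norm w = 1" "x \<bullet> w = 0" "\<And>l. l \<in> L \<Longrightarrow> D l \<bullet> w = 0"
    by (metis subspace_dim_less_ortho image_eqI insertCI)
  obtain d1 where d1: "d1 > 0"
    "\<And>p q. p \<in> ball x d1 \<Longrightarrow> q \<in> ball x d1 \<Longrightarrow> norm (\<psi> p - \<psi> q - E (p - q)) \<le> norm (p - q)"
    using E(2)[of 1] by auto
  define B where "B = 1 + onorm E"
  have "B > 0" unfolding B_def using onorm_pos_le[OF E(1)] by linarith
  have lip: "norm (\<psi> p - \<psi> q) \<le> B * norm (p - q)" if "p \<in> ball x d1" "q \<in> ball x d1" for p q
  proof -
    have "norm (\<psi> p - \<psi> q) \<le> norm (\<psi> p - \<psi> q - E (p - q)) + norm (E (p - q))"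
      by (metis diff_add_cancel norm_triangle_ineq)
    then show ?thesis
      using d1(2)[OF that] onorm[OF E(1), of "p - q"] by (simp add: B_def algebra_simps)
  qed
  \<comment> \<open>The accuracy \<open>1 / (8 * B)\<close> cancels the Lipschitz constant
    \<open>B\<close> of the chart and leaves slope 1/8 on \<open>V\<close>.\<close>
  obtain d2 where d2: "d2 > 0"
    "\<And>a b. a \<in> ball (\<psi> x) d2 \<Longrightarrow> b \<in> ball (\<psi> x) d2 \<Longrightarrow>
       norm (\<phi> a - \<phi> b - D (a - b)) \<le> 1 / (8 * B) * norm (a - b)"
    using D(2)[of "1 / (8 * B)"] \<open>B > 0\<close> by auto
  obtain d3 where d3: "d3 > 0" "ball x d3 \<subseteq> U" using U open_contains_ball by blast
  define d where "d = min (min d1 d3) (d2 / B)"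
  have "d > 0" using d1 d2 d3 \<open>B > 0\<close> by (simp add: d_def)
  have flatV: "\<bar>(p - q) \<bullet> w\<bar> \<le> norm (p - q) / 8"
    if p: "p \<in> V \<inter> ball x d" and q: "q \<in> V \<inter> ball x d" for p q
  proof -
    have inU: "y \<in> U" "\<psi> y \<in> L" "\<psi> y \<in> ball (\<psi> x) d2" "\<phi> (\<psi> y) = y" "y \<in> ball x d1"
      if y: "y \<in> V \<inter> ball x d" for y
    proof -
      show "y \<in> U" using y d3 by (auto simp: d_def)
      then show "\<psi> y \<in> L" using flat y by blast
      show "\<phi> (\<psi> y) = y" using \<open>y \<in> U\<close> psi(2) by (simp add: \<phi>_def)
      show y1: "y \<in> ball x d1" using y by (auto simp: d_def)
      have "norm (\<psi> x - \<psi> y) \<le> B * norm (x - y)" using lip[of x y] y1 d1 by auto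
      also have "\<dots> < B * d" using y \<open>B > 0\<close> by (auto simp: dist_norm)
      also have "\<dots> \<le> d2" using \<open>B > 0\<close> by (auto simp: d_def min_def field_simps)
      finally show "\<psi> y \<in> ball (\<psi> x) d2" by (simp add: dist_norm)
    qed
    note P = inU[OF p] and Q = inU[OF q]
    have "\<psi> p - \<psi> q \<in> L" using P Q L by (simp add: subspace_diff)
    then have "(p - q) \<bullet> w = (\<phi> (\<psi> p) - \<phi> (\<psi> q) - D (\<psi> p - \<psi> q)) \<bullet> w"
      using w(3) P Q by (simp add: inner_diff_left)
    also have "\<bar>\<dots>\<bar> \<le> norm (\<phi> (\<psi> p) - \<phi> (\<psi> q) - D (\<psi> p - \<psi> q))"
      by (metis Cauchy_Schwarz_ineq2 mult.right_neutral w(1))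
    also have "\<dots> \<le> 1 / (8 * B) * norm (\<psi> p - \<psi> q)" using d2 P Q by blast
    also have "\<dots> \<le> 1 / (8 * B) * (B * norm (p - q))"
      using lip P Q \<open>B > 0\<close> by (intro mult_left_mono) auto
    finally show ?thesis using \<open>B > 0\<close> by simp
  qed
  \<comment> \<open>Radial projection at most doubles the distance to the unit vector
    \<open>x\<close>, so the projected points stay within \<open>d\<close> and within 1/4 of
    \<open>x\<close>. The slope on the cone is then at most 2 * (1/8) from the spherical part plus
    1/4 from the radial part, that is 1/2.\<close>
  define r where "r = min (1 / 8) (d / 2)"
  have "r > 0" using \<open>d > 0\<close> by (simp add: r_def)
  have "\<bar>(p - q) \<bullet> w\<bar> \<le> norm (p - q) / 2"
    if p: "p \<in> scone V \<inter> ball x r" and q: "q \<in> scone V \<inter> ball x r" for p q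
  proof -
    define p' where "p' = p /\<^sub>R norm p"
    define q' where "q' = q /\<^sub>R norm q"
    have ne: "p \<noteq> 0" "q \<noteq> 0" "p' \<in> V" "q' \<in> V" using p q by (auto simp: scone_def p'_def q'_def)
    have near: "norm (x - y /\<^sub>R norm y) < 2 * r" if "y \<noteq> 0" "y \<in> ball x r" for y
      using norm_sgn_diff_le[of x y] that \<open>x \<noteq> 0\<close> \<open>norm x = 1\<close> by (simp add: dist_norm)
    have "2 * r \<le> d" "2 * r \<le> 1 / 4" by (auto simp: r_def min_def)
    then have 1: "\<bar>(p' - q') \<bullet> w\<bar> \<le> norm (p' - q') / 8"
      using ne near[of p] near[of q] p q
      by (intro flatV) (auto simp: p'_def q'_def dist_norm)
    have "q' \<bullet> w = (q' - x) \<bullet> w" by (simp add: inner_diff_left w)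
    also have "\<bar>\<dots>\<bar> \<le> norm (q' - x)" by (metis Cauchy_Schwarz_ineq2 mult.right_neutral w(1))
    also have "\<dots> \<le> 1 / 4" using near[of q] ne q \<open>2 * r \<le> 1 / 4\<close> by (simp add: q'_def norm_minus_commute)
    finally have 2: "\<bar>q' \<bullet> w\<bar> \<le> 1 / 4" .
    have "(p - q) \<bullet> w = norm p * ((p' - q') \<bullet> w) + (norm p - norm q) * (q' \<bullet> w)"
      using ne by (simp add: p'_def q'_def inner_diff_left left_diff_distrib right_diff_distrib flip: mult.assoc)
    also have "\<bar>\<dots>\<bar> \<le> norm p * (norm (p' - q') / 8) + norm (p - q) * (1 / 4)"
      by (rule order_trans[OF abs_triangle_ineq], unfold abs_mult abs_norm_cancel,
          intro add_mono mult_mono 1 2 norm_triangle_ineq3) auto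
    also have "\<dots> \<le> norm (p - q) / 2"
      using norm_sgn_diff_le[OF ne(1,2)] unfolding p'_def q'_def by linarith
    finally show ?thesis .
  qed
  then show ?thesis using that[of w r] w(1) \<open>r > 0\<close> by blast
qed

text \<open>A chart with \<open>dim L\<close> at least \<open>DIM('a) - 1\<close> would make
  \<open>V\<close> a neighbourhood of \<open>x\<close> in the sphere, by invariance of domain. Being
  in the closure of \<Omega>, \<open>x\<close> has points of \<Omega> arbitrarily close, and these
  would lie in \<open>V\<close>.\<close>

lemma frontier_chart_dim:
  fixes V :: "'a::euclidean_space set" and \<psi> :: "'a \<Rightarrow> 'a"
  assumes sub: "V \<subseteq> sphere 0 1" and x: "x \<in> V" "x \<in> closure \<Omega>"
    and dis: "V \<inter> \<Omega> = {}" and om: "\<Omega> \<subseteq> sphere 0 1"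
    and U: "open U" "x \<in> U" and L: "subspace L"
    and psi: "inj_on \<psi> U" "open (\<psi> ` U)" "smooth_on (\<psi> ` U) (inv_into U \<psi>)"
    and flat: "\<psi> ` (U \<inter> V) = \<psi> ` U \<inter> L"
  shows "dim L + 2 \<le> DIM('a)"
proof (rule ccontr)
  assume "\<not> ?thesis"
  then have dL: "DIM('a) - 1 \<le> dim L" by linarith
  define \<phi> where "\<phi> = inv_into U \<psi>"
  \<comment> \<open>The projection \<open>pr\<close> along \<open>x\<close> is injective on the open
    hemisphere \<open>H\<close>. It serves as a chart of the sphere, so that invariance of domain
    can be applied between the linear spaces \<open>L\<close> and the hyperplane orthogonal to
    \<open>x\<close>.\<close>
  define H where "H = {z. 0 < x \<bullet> z}"
  define pr where "pr = (\<lambda>z. z - (x \<bullet> z) *\<^sub>R x)"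
  have nx: "norm x = 1" "x \<bullet> x = 1" using sub x by (auto simp: dot_square_norm)
  then have "x \<noteq> 0" by auto
  have "ck_on 0 (\<psi> ` U) \<phi>" using psi unfolding smooth_on_def \<phi>_def by blast
  then have cphi: "continuous_on (\<psi> ` U) \<phi>" by simp
  have phi_psi: "\<phi> (\<psi> y) = y" if "y \<in> U" for y using that psi by (simp add: \<phi>_def)
  define S where "S = \<psi> ` (U \<inter> V \<inter> H)"
  have "\<psi> ` U \<inter> \<phi> -` H = \<psi> ` (U \<inter> H)" using phi_psi by auto
  moreover have "open (\<psi> ` U \<inter> \<phi> -` H)"
    using cphi psi(2) open_halfspace_gt[of 0 x] by (intro continuous_open_preimage) (auto simp: H_def)
  ultimately have "open (\<psi> ` (U \<inter> H))" by simp
  moreover have "S = L \<inter> \<psi> ` (U \<inter> H)"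
  proof -
    have "\<psi> ` (U \<inter> V \<inter> H) = \<psi> ` (U \<inter> V) \<inter> \<psi> ` (U \<inter> H)"
      using psi(1) by (auto simp: inj_on_def)
    also have "\<dots> = L \<inter> \<psi> ` (U \<inter> H)" using flat by auto
    finally show ?thesis by (simp add: S_def)
  qed
  ultimately have "openin (top_of_set L) S" by (auto simp: openin_open)
  moreover have "continuous_on S (pr \<circ> \<phi>)"
    by (intro continuous_on_compose continuous_on_subset[OF cphi])
       (auto simp: S_def pr_def intro!: continuous_intros)
  moreover have pr_perp: "pr y \<in> {z. x \<bullet> z = 0}" for y by (simp add: pr_def inner_diff_right nx)
  have pr_inj: "y = z" if "norm y = 1" "norm z = 1" "y \<in> H" "z \<in> H" "pr y = pr z" for y z
  proof -
    have "pr y \<bullet> pr y = 1 - (x \<bullet> y)\<^sup>2" if "norm y = 1" for y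
    proof -
      have "y \<bullet> y = 1" using that by (simp add: dot_square_norm)
      then show ?thesis using nx(2)
        by (simp add: pr_def inner_diff_left inner_diff_right inner_commute power2_eq_square)
    qed
    then have "(x \<bullet> y)\<^sup>2 = (x \<bullet> z)\<^sup>2" using that(1,2,5) by (metis diff_diff_eq2 diff_add_cancel cancel_ab_semigroup_add_class.add_diff_cancel_left')
    then have "x \<bullet> y = x \<bullet> z" using that by (simp add: H_def power2_eq_iff)
    then show ?thesis using that(5) by (simp add: pr_def)
  qed
  moreover have "inj_on (pr \<circ> \<phi>) S"
  proof (rule inj_onI)
    fix a b assume "a \<in> S" "b \<in> S" and e: "(pr \<circ> \<phi>) a = (pr \<circ> \<phi>) b"
    then obtain y z where yz: "a = \<psi> y" "b = \<psi> z" "y \<in> U \<inter> V \<inter> H" "z \<in> U \<inter> V \<inter> H"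
      by (auto simp: S_def)
    then have "pr y = pr z" using e by (simp add: phi_psi)
    moreover have "norm y = 1" "norm z = 1" using yz sub by auto
    ultimately have "y = z" using yz pr_inj[of y z] by blast
    then show "a = b" using yz by simp
  qed
  ultimately have "openin (top_of_set {z. x \<bullet> z = 0}) ((pr \<circ> \<phi>) ` S)"
    using dL L \<open>x \<noteq> 0\<close>
    by (intro invariance_of_domain_subspaces[of L]) (use pr_perp in \<open>auto simp: subspace_hyperplane dim_hyperplane\<close>)
  moreover have "0 \<in> (pr \<circ> \<phi>) ` S"
  proof -
    have "\<psi> x \<in> S" "pr x = 0" using x U nx by (auto simp: S_def H_def pr_def)
    then show ?thesis by (metis U(2) comp_apply imageI phi_psi)
  qed
  ultimately obtain e where e: "e > 0" "ball 0 e \<inter> {z. x \<bullet> z = 0} \<subseteq> (pr \<circ> \<phi>) ` S"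
    by (auto simp: openin_contains_ball)
  \<comment> \<open>Distance below \<open>e\<close> puts \<open>pr y\<close> into the image of
    \<open>V\<close>; distance below 1 puts \<open>y\<close> into the hemisphere where
    \<open>pr\<close> is injective.\<close>
  obtain y where y: "y \<in> \<Omega>" "dist y x < min e 1"
    using x(2) e(1) by (metis closure_approachable min_less_iff_conj zero_less_one)
  have ny: "norm y = 1" using y om by auto
  have "(norm (y - x))\<^sup>2 = 2 - 2 * (x \<bullet> y)"
    using nx ny dot_norm_neg[of y x] by (simp add: inner_commute)
  moreover have "(norm (y - x))\<^sup>2 < 1" using y(2) by (simp add: dist_norm power_less_one_iff)
  ultimately have yH: "y \<in> H" by (simp add: H_def)
  have "pr y = pr (y - x)" using nx by (simp add: pr_def inner_diff_right algebra_simps)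
  then have "(norm (pr y))\<^sup>2 = (norm (y - x))\<^sup>2 - (x \<bullet> (y - x))\<^sup>2"
    using nx unfolding pr_def power2_norm_eq_inner
    by (simp add: algebra_simps inner_commute power2_eq_square)
  then have "(norm (pr y))\<^sup>2 \<le> (norm (y - x))\<^sup>2" by simp
  then have "norm (pr y) \<le> norm (y - x)" by (rule power2_le_imp_le) simp
  then have "pr y \<in> ball 0 e" using y(2) by (simp add: dist_norm)
  then obtain v where v: "v \<in> U \<inter> V \<inter> H" "pr y = pr v"
    using e(2) pr_perp[of y] by (auto simp: S_def phi_psi subset_iff image_iff)
  moreover have "norm v = 1" using v sub by auto
  ultimately have "y = v" using ny yH pr_inj[of y v] by blast
  then show False using v y dis by auto
qed

text \<open>Near \<open>x\<close>, every secant of \<open>M\<close> makes an angle of at least 60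
  degrees with the line spanned by \<open>w\<close>. A condition on pairs of points passes to
  subsets and holds trivially when \<open>M\<close> misses the ball.\<close>

definition transversal :: "'a::real_inner set \<Rightarrow> 'a \<Rightarrow> 'a \<Rightarrow> real \<Rightarrow> bool" where
  "transversal M x w r \<longleftrightarrow> norm w = 1 \<and> r > 0 \<and>
     (\<forall>p\<in>M \<inter> ball x r. \<forall>q\<in>M \<inter> ball x r. \<bar>(p - q) \<bullet> w\<bar> \<le> norm (p - q) / 2)"

lemma transversal_mono:
  assumes "transversal M x w r" "N \<inter> ball x s \<subseteq> M" "0 < s" "s \<le> r"
  shows "transversal N x w s"
proof -
  have "p \<in> M \<inter> ball x r" if "p \<in> N \<inter> ball x s" for p using assms that by auto
  then show ?thesis using assms unfolding transversal_def by blast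
qed

lemma transversal_scone_scaleR:
  fixes x :: "'a::euclidean_space"
  assumes "transversal (scone V) x w r" "c > 0"
  shows "transversal (scone V) (c *\<^sub>R x) w (c * r)"
proof -
  have "\<bar>(p - q) \<bullet> w\<bar> \<le> norm (p - q) / 2"
    if p: "p \<in> scone V \<inter> ball (c *\<^sub>R x) (c * r)" and q: "q \<in> scone V \<inter> ball (c *\<^sub>R x) (c * r)" for p q
  proof -
    have *: "y /\<^sub>R c \<in> scone V \<inter> ball x r" if "y \<in> scone V \<inter> ball (c *\<^sub>R x) (c * r)" for y
    proof -
      have "norm (c *\<^sub>R x - y) = c * norm (x - y /\<^sub>R c)"
      proof -
        have "c *\<^sub>R (x - y /\<^sub>R c) = c *\<^sub>R x - y" using assms(2) by (simp add: scaleR_diff_right)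
        then show ?thesis using assms(2) by (metis abs_of_pos norm_scaleR)
      qed
      then show ?thesis
        using that assms(2) by (simp add: scone_scaleR dist_norm)
    qed
    have "\<bar>(p /\<^sub>R c - q /\<^sub>R c) \<bullet> w\<bar> \<le> norm (p /\<^sub>R c - q /\<^sub>R c) / 2"
      using assms(1) *[OF p] *[OF q] unfolding transversal_def by blast
    then show ?thesis
      using assms(2) by (simp add: abs_mult flip: scaleR_diff_right)
  qed
  then show ?thesis using assms by (auto simp: transversal_def)
qed

text \<open>The chart argument is made at the unit vector and scaled to \<open>x\<close>. Of the two
  boundary pieces only the one through the direction of \<open>x\<close> matters locally, since the
  other is closed and disjoint from it.\<close>

lemma scone_frontier_transversal:
  fixes \<Omega> V1 V2 :: "'a::euclidean_space set"
  assumes om: "\<Omega> \<subseteq> sphere 0 1" "openin (top_of_set (sphere 0 1)) \<Omega>"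
    and bdry: "closure \<Omega> - \<Omega> = V1 \<union> V2" and disj: "V1 \<inter> V2 = {}"
    and V: "compact_submanifold_of_sphere V1" "compact_submanifold_of_sphere V2"
    and x: "x \<in> scone (closure \<Omega>)"
  obtains w r where "transversal (scone (closure \<Omega> - \<Omega>)) x w r"
proof -
  have one: "\<exists>w r. transversal (scone (closure \<Omega> - \<Omega>)) x w r"
    if xV: "x /\<^sub>R norm x \<in> V" and V: "compact_submanifold_of_sphere V"
      and V': "compact_submanifold_of_sphere V'" and eq: "closure \<Omega> - \<Omega> = V \<union> V'" "V \<inter> V' = {}" for V V'
  proof -
    define x' where "x' = x /\<^sub>R norm x"
    have "x \<noteq> 0" using x by (simp add: scone_def)
    have VV: "V \<subseteq> sphere 0 1" "closed V'" "V' \<subseteq> sphere 0 1" "emb_submanifold V"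
      using V V' by (auto simp: compact_submanifold_of_sphere_def compact_imp_closed)
    obtain U L and \<psi> :: "'a \<Rightarrow> 'a" where U: "open U" "x' \<in> U" "subspace L"
      "smooth_on U \<psi>" "inj_on \<psi> U" "open (\<psi> ` U)"
      "smooth_on (\<psi> ` U) (inv_into U \<psi>)" "\<psi> ` (U \<inter> V) = \<psi> ` U \<inter> L"
      using VV(4) xV unfolding emb_submanifold_def x'_def by blast
    have x': "x' \<in> V" "x' \<in> closure \<Omega>" "V \<inter> \<Omega> = {}" using xV eq unfolding x'_def by blast+
    have "dim L + 2 \<le> DIM('a)"
      by (rule frontier_chart_dim[OF VV(1) x' om(1) U(1-3) U(5-8)])
    then obtain w r where "norm w = 1" "r > 0"
      "\<And>p q. p \<in> scone V \<inter> ball x' r \<Longrightarrow> q \<in> scone V \<inter> ball x' r \<Longrightarrow> \<bar>(p - q) \<bullet> w\<bar> \<le> norm (p - q) / 2"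
      using submanifold_transversal[OF VV(1) x'(1) U(1-3) _ U(4-8)] by metis
    then have "transversal (scone V) x' w r" by (simp add: transversal_def)
    from transversal_scone_scaleR[OF this, of "norm x"] have t: "transversal (scone V) x w (norm x * r)"
      using \<open>x \<noteq> 0\<close> by (simp add: x'_def)
    have "openin (top_of_set (sphere 0 1)) (sphere 0 1 - V')"
      using VV(2) by (auto simp: openin_open)
    from open_scone[OF this] have "open (scone (sphere 0 1 - V'))" .
    moreover have "x \<in> scone (sphere 0 1 - V')"
      using \<open>x \<noteq> 0\<close> x' VV(1) eq(2) by (auto simp: scone_def x'_def)
    ultimately obtain s where s: "s > 0" "ball x s \<subseteq> scone (sphere 0 1 - V')"
      using open_contains_ball by blast
    have "transversal (scone (closure \<Omega> - \<Omega>)) x w (min s (norm x * r))"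
    proof (rule transversal_mono[OF t])
      show "scone (closure \<Omega> - \<Omega>) \<inter> ball x (min s (norm x * r)) \<subseteq> scone V"
        unfolding eq using s(2) by (auto simp: scone_def)
    qed (use s t in \<open>auto simp: transversal_def\<close>)
    then show ?thesis by blast
  qed
  consider "x /\<^sub>R norm x \<in> V1" | "x /\<^sub>R norm x \<in> V2" | "x \<in> scone \<Omega>"
    using x bdry by (auto simp: scone_def)
  then have "\<exists>w r. transversal (scone (closure \<Omega> - \<Omega>)) x w r"
  proof cases
    case 1 then show ?thesis using one[OF 1 V] bdry disj by simp
  next
    case 2 then show ?thesis using one[OF 2 V(2,1)] bdry disj by (simp add: Un_commute Int_commute)
  next
    \<comment> \<open>Over \<Omega> itself a small ball misses the cone over the boundary, so any
      unit vector will do.\<close>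
    case 3
    then obtain r where r: "r > 0" "ball x r \<subseteq> scone \<Omega>"
      using open_scone[OF om(2)] open_contains_ball by blast
    obtain b :: 'a where "b \<in> Basis" using nonempty_Basis by blast
    moreover have "scone (closure \<Omega> - \<Omega>) \<inter> ball x r = {}"
      using r(2) by (auto simp: scone_def)
    ultimately have "transversal (scone (closure \<Omega> - \<Omega>)) x b r"
      using r(1) by (simp add: transversal_def)
    then show ?thesis by blast
  qed
  then show ?thesis using that by blast
qed

section \<open>Crossing the boundary along lines close to the transversal direction\<close>

lemma segment_subset_of_frontier:
  fixes p :: "'a::real_normed_vector"
  assumes "p \<in> K" "closed_segment p q \<subseteq> ball x r" "frontier K \<inter> ball x r \<subseteq> M"
    "closed_segment p q \<inter> M = {}"
  shows "closed_segment p q \<subseteq> K"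
  using connected_Int_frontier[of "closed_segment p q" K] assms connected_segment(1)[of p q]
    ends_in_segment(1)[of p q] by blast

text \<open>The assumption on \<open>v\<close> says that \<open>v\<close> is less than 60 degrees
  away from the line of \<open>w\<close>, whereas secants of \<open>M\<close> are at least 60
  degrees away from it.\<close>

lemma transversal_line_unique:
  assumes "transversal M x w r" "norm v < 2 * \<bar>v \<bullet> w\<bar>"
    "p \<in> M \<inter> ball x r" "p + c *\<^sub>R v \<in> M \<inter> ball x r"
  shows "c = 0"
proof (rule ccontr)
  assume "c \<noteq> 0"
  have "\<bar>(p + c *\<^sub>R v - p) \<bullet> w\<bar> \<le> norm (p + c *\<^sub>R v - p) / 2"
    using assms unfolding transversal_def by blast
  then have "\<bar>c\<bar> * \<bar>v \<bullet> w\<bar> \<le> \<bar>c\<bar> * (norm v / 2)" by (simp add: abs_mult)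
  then show False using \<open>c \<noteq> 0\<close> assms(2) by (simp add: mult_le_cancel_left_pos)
qed

text \<open>If both endpoints were outside \<open>K\<close>, both halves of the segment would meet
  \<open>M\<close>. Both meeting points lie on one admissible line, so they coincide, and the only
  common point of the halves is \<open>p\<close>, which is not in \<open>M\<close>.\<close>

lemma transversal_step:
  assumes t: "transversal M x w r" and v: "norm v < 2 * \<bar>v \<bullet> w\<bar>"
    and fr: "frontier K \<inter> ball x r \<subseteq> M" and KM: "K \<inter> M = {}"
    and p: "p \<in> K" "p \<in> ball x r" "p + v \<in> ball x r" "p - v \<in> ball x r"
  shows "p + v \<in> K \<or> p - v \<in> K"
proof (rule ccontr)
  assume n: "\<not> ?thesis"
  have sub: "closed_segment p (p + v) \<subseteq> ball x r" "closed_segment p (p - v) \<subseteq> ball x r"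
    by (rule closed_segment_subset[OF p(2,3) convex_ball] closed_segment_subset[OF p(2,4) convex_ball])+
  have "closed_segment p (p + v) \<inter> M \<noteq> {}" "closed_segment p (p - v) \<inter> M \<noteq> {}"
    using segment_subset_of_frontier[OF p(1) sub(1) fr] segment_subset_of_frontier[OF p(1) sub(2) fr] n
    by auto
  then obtain a b where ab: "a \<in> closed_segment p (p + v)" "a \<in> M" "b \<in> closed_segment p (p - v)" "b \<in> M"
    by blast
  then obtain s u where su: "a = p + s *\<^sub>R v" "b = p - u *\<^sub>R v" "0 \<le> s" "0 \<le> u"
    by (auto simp: in_segment algebra_simps)
  have "b = a + (- u - s) *\<^sub>R v" by (simp add: su algebra_simps)
  then have "- u - s = 0"
    using transversal_line_unique[OF t v, of a "- u - s"] ab sub by blast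
  then have "s = 0" using su by linarith
  then show False using su ab p KM by auto
qed

text \<open>The point \<open>z\<close> is the single crossing with \<open>M\<close>, or just
  \<open>p\<close> if there is none. A derivative estimate is available on the two open pieces in
  \<open>K\<close>, and continuity at \<open>z\<close> joins them.\<close>

lemma transversal_segment:
  fixes x :: "'a::euclidean_space"
  assumes t: "transversal M x w r" and v: "norm (q - p) < 2 * \<bar>(q - p) \<bullet> w\<bar>"
    and fr: "frontier K \<inter> ball x r \<subseteq> M"
    and p: "p \<in> K" "p \<in> ball x r" and q: "q \<in> K" "q \<in> ball x r"
  obtains z where "z \<in> closed_segment p q" "open_segment p z \<subseteq> K" "open_segment z q \<subseteq> K" "z \<in> K \<union> M"
proof (cases "closed_segment p q \<inter> M = {}")
  case True
  have "closed_segment p q \<subseteq> ball x r" using p q by (intro closed_segment_subset convex_ball)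
  from segment_subset_of_frontier[OF p(1) this fr True] show ?thesis
    using p(1) by (intro that[of p]) (auto simp: open_segment_def)
next
  case False
  then obtain z where z: "z \<in> closed_segment p q" "z \<in> M" by blast
  have sub: "closed_segment p q \<subseteq> ball x r" using p q by (intro closed_segment_subset convex_ball)
  have uniq: "y = z" if y: "y \<in> closed_segment p q" "y \<in> M" for y
  proof -
    have "\<exists>s. y' = p + s *\<^sub>R (q - p)" if "y' \<in> closed_segment p q" for y'
      using that by (auto simp: in_segment algebra_simps)
    then obtain s u where "y = p + s *\<^sub>R (q - p)" "z = p + u *\<^sub>R (q - p)"
      using z(1) y(1) by meson
    then have y': "y = z + (s - u) *\<^sub>R (q - p)" by (simp add: scaleR_left_diff_distrib)
    then have "s - u = 0"
      using transversal_line_unique[OF t v, of z "s - u"] z y y' sub by blast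
    then show ?thesis using y' by simp
  qed
  have part: "open_segment a z \<subseteq> K" if a: "a \<in> K" "a = p \<or> a = q" for a
  proof
    fix y assume y: "y \<in> open_segment a z"
    have az: "closed_segment a z \<subseteq> closed_segment p q" using a z by (auto simp: subset_closed_segment)
    have ay: "closed_segment a y \<subseteq> closed_segment a z"
      using y by (auto simp: subset_closed_segment open_segment_def)
    \<comment> \<open>The part of the segment strictly before the crossing point contains no point
      of \<open>M\<close>, so it cannot leave \<open>K\<close>.\<close>
    have "z \<notin> closed_segment a y"
    proof
      assume "z \<in> closed_segment a y"
      then have "dist a z \<le> dist a y" using dist_in_closed_segment[of z a y] by (simp add: dist_commute)
      moreover have "dist a y < dist a z" using dist_in_open_segment[OF y] by (simp add: dist_commute)
      ultimately show False by simp
    qed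
    then have "closed_segment a y \<inter> M = {}" using uniq ay az by blast
    then have "closed_segment a y \<subseteq> K"
      using a ay az sub fr by (intro segment_subset_of_frontier[of a K y x r M]) auto
    then show "y \<in> K" by auto
  qed
  show ?thesis
    using that[of z] part[of p] part[of q] z p q by (auto simp: open_segment_commute)
qed

text \<open>The difference \<open>N\<close> of two derivatives is small on increments into
  \<open>S\<close>. For \<open>v\<close> close to the line of \<open>w\<close>, some point
  \<open>y\<close> of \<open>K\<close> near \<open>x\<close> has \<open>y + A *\<^sub>R v\<close> or
  \<open>y - A *\<^sub>R v\<close> in \<open>K\<close>; subtracting the two increments isolates
  \<open>N v\<close> and shows that it vanishes. Such \<open>v\<close> span the space.\<close>

lemma transversal_has_derivative_unique:
  fixes f :: "'a::real_inner \<Rightarrow> 'b::real_normed_vector"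
  assumes t: "transversal M x w r"
    and fr: "frontier K \<inter> ball x r \<subseteq> M" and KM: "K \<inter> M = {}"
    and x: "x \<in> closure K" and KS: "K \<subseteq> S"
    and D: "(f has_derivative D1) (at x within S)" "(f has_derivative D2) (at x within S)"
  shows "D1 = D2"
proof -
  define N where "N v = D1 v - D2 v" for v
  have "((\<lambda>y. f y - f y) has_derivative N) (at x within S)"
    unfolding N_def using D by (intro has_derivative_diff)
  then have N: "bounded_linear N"
    "\<And>e. e > 0 \<Longrightarrow> \<exists>d>0. \<forall>y\<in>S. norm (y - x) < d \<longrightarrow> norm (N (y - x)) \<le> e * norm (y - x)"
    by (auto simp: has_derivative_within_alt)
  interpret N: bounded_linear N by (rule N)
  have w: "norm w = 1" "r > 0" using t by (auto simp: transversal_def)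
  have good: "N v = 0" if v: "norm v < 2 * \<bar>v \<bullet> w\<bar>" for v
  proof (rule ccontr)
    assume "N v \<noteq> 0"
    have "v \<noteq> 0" using v by auto
    \<comment> \<open>Chosen so that the final bound
      \<open>norm (N v) \<le> e * (norm v + 2)\<close> would give at most half of
      \<open>norm (N v)\<close>.\<close>
    define e where "e = min 1 (norm (N v) / (2 * (norm v + 2)))"
    have pos: "norm v > 0" "norm v + 2 > 0" "norm (N v) > 0" "norm (N v) / (2 * (norm v + 2)) > 0"
      using \<open>N v \<noteq> 0\<close> \<open>v \<noteq> 0\<close> by (auto intro!: divide_pos_pos add_pos_pos)
    have e: "e > 0" "e \<le> 1" using pos by (auto simp: e_def)
    obtain d where d: "d > 0" "\<And>y. y \<in> S \<Longrightarrow> norm (y - x) < d \<Longrightarrow> norm (N (y - x)) \<le> e * norm (y - x)"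
      using N(2)[OF e(1)] by blast
    \<comment> \<open>The step length keeps \<open>y\<close>, and its translates by
      \<open>A *\<^sub>R v\<close> in both directions, within \<open>min d r\<close> of
      \<open>x\<close> even after the error of size at most \<open>A\<close> in the choice of
      \<open>y\<close>.\<close>
    define A where "A = min d r / (2 * (norm v + 1))"
    have A: "A > 0" using d w pos unfolding A_def by (intro divide_pos_pos mult_pos_pos add_pos_pos) auto
    have "A * (norm v + 1) = min d r / 2" 
    proof -
      have "norm v + 1 > 0" using pos by linarith
      then show ?thesis unfolding A_def by (simp add: divide_simps)
    qed
    moreover have "min d r > 0" using d w by simp
    ultimately have A2: "A * norm v + A < min d r" unfolding distrib_left by linarith
    obtain y where y: "y \<in> K" "dist y x < e * A"
      using x A e by (metis closure_approachable mult_pos_pos)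
    then have yx: "norm (y - x) < e * A" by (simp add: dist_norm)
    have "e * A \<le> A" using e A by (simp add: mult_left_le_one_le)
    have nm: "norm (y + s *\<^sub>R (A *\<^sub>R v) - x) \<le> A * norm v + e * A" if "\<bar>s\<bar> = 1" for s
    proof -
      have "norm (y + s *\<^sub>R (A *\<^sub>R v) - x) \<le> norm (s *\<^sub>R (A *\<^sub>R v)) + norm (y - x)"
        by (metis add.commute add_diff_eq norm_triangle_ineq)
      moreover have "norm (s *\<^sub>R (A *\<^sub>R v)) = A * norm v" using that A by (simp add: abs_mult)
      ultimately show ?thesis using yx by linarith
    qed
    then have nm': "norm (y + s *\<^sub>R (A *\<^sub>R v) - x) < min d r" if "\<bar>s\<bar> = 1" for s
      using A2 \<open>e * A \<le> A\<close> nm[OF that] by linarith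
    have "y + A *\<^sub>R v \<in> K \<or> y - A *\<^sub>R v \<in> K"
    proof (rule transversal_step[OF t _ fr KM y(1)])
      show "norm (A *\<^sub>R v) < 2 * \<bar>A *\<^sub>R v \<bullet> w\<bar>" using A v by (simp add: abs_mult)
      have "0 \<le> A * norm v" using A by simp
      then show "y \<in> ball x r" using yx A2 \<open>e * A \<le> A\<close>
        by (simp add: dist_norm norm_minus_commute[of x])
      show "y + A *\<^sub>R v \<in> ball x r" "y - A *\<^sub>R v \<in> ball x r"
        using nm'[of 1] nm'[of "-1"] by (auto simp: dist_norm norm_minus_commute[of x])
    qed
    then obtain s :: real where s: "\<bar>s\<bar> = 1" "y + s *\<^sub>R (A *\<^sub>R v) \<in> K"
      by (metis abs_1 abs_minus_cancel scaleR_minus1_left scaleR_one uminus_add_conv_diff add.commute)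
    have "norm (N (y + s *\<^sub>R (A *\<^sub>R v) - x)) \<le> e * norm (y + s *\<^sub>R (A *\<^sub>R v) - x)"
      using d(2) s KS nm'[OF s(1)] by auto
    also have "\<dots> \<le> e * (A * norm v + A)"
      using nm[OF s(1)] e \<open>e * A \<le> A\<close> by (intro mult_left_mono) auto
    finally have 1: "norm (N (y + s *\<^sub>R (A *\<^sub>R v) - x)) \<le> e * (A * norm v + A)" .
    have "norm (N (y - x)) \<le> e * norm (y - x)"
    proof (rule d(2))
      have "0 \<le> A * norm v" using A by simp
      then show "norm (y - x) < d" using yx A2 \<open>e * A \<le> A\<close> by simp
    qed (use y KS in auto)
    also have "\<dots> \<le> e * A" using yx \<open>e * A \<le> A\<close> e by (intro mult_left_mono) auto
    finally have 2: "norm (N (y - x)) \<le> e * A" .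
    have "s *\<^sub>R (A *\<^sub>R N v) = N (y + s *\<^sub>R (A *\<^sub>R v) - x) - N (y - x)"
      by (simp add: N.diff N.add N.scaleR)
    then have "A * norm (N v) = norm (N (y + s *\<^sub>R (A *\<^sub>R v) - x) - N (y - x))"
      using s(1) A by (metis abs_of_pos mult_1 norm_scaleR)
    also have "\<dots> \<le> e * (A * norm v + A) + e * A"
      using 1 2 norm_triangle_ineq4 by (meson add_mono order_trans)
    also have "\<dots> = A * (e * (norm v + 2))" by (simp add: algebra_simps)
    finally have "norm (N v) \<le> e * (norm v + 2)" using A by simp
    also have "\<dots> \<le> norm (N v) / (2 * (norm v + 2)) * (norm v + 2)"
      using pos by (intro mult_right_mono) (auto simp: e_def)
    also have "\<dots> = norm (N v) / 2" using pos(2) by (simp add: divide_simps)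
    finally show False using pos by simp
  qed
  \<comment> \<open>A small multiple of any \<open>u\<close> added to \<open>w\<close> is still
    close enough to the direction of \<open>w\<close>, so linearity extends the vanishing to all
    \<open>u\<close>.\<close>
  have "N u = 0" for u
  proof -
    define h where "h = 1 / (4 * (norm u + 1))"
    have h: "h > 0" by (simp add: h_def add_nonneg_pos)
    have hu: "h * norm u < 1 / 4"
    proof -
      have "h * norm u < h * (norm u + 1)" using h by simp
      also have "\<dots> = 1 / 4" using add_nonneg_pos[of "norm u" 1] by (simp add: h_def)
      finally show ?thesis .
    qed
    have ww: "w \<bullet> w = 1" using w by (simp add: dot_square_norm)
    have "\<bar>u \<bullet> w\<bar> \<le> norm u" by (metis Cauchy_Schwarz_ineq2 mult.right_neutral w(1))
    then have "\<bar>h *\<^sub>R u \<bullet> w\<bar> \<le> h * norm u" using h by (simp add: abs_mult)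
    then have "\<bar>(w + h *\<^sub>R u) \<bullet> w\<bar> > 3 / 4" using hu ww by (simp add: inner_add_left)
    moreover have "norm (w + h *\<^sub>R u) \<le> 1 + h * norm u"
      using norm_triangle_ineq[of w "h *\<^sub>R u"] w h by simp
    ultimately have "N (w + h *\<^sub>R u) = 0" using hu by (intro good) linarith
    moreover have "N w = 0" by (rule good) (simp add: ww w)
    ultimately show ?thesis using h by (simp add: N.add N.scaleR)
  qed
  then show ?thesis by (auto simp: N_def fun_eq_iff)
qed

text \<open>Differentiability is asked only on the open segment, because an endpoint may be the
  crossing point on the boundary.\<close>

lemma segment_derivative_bound:
  fixes f :: "'a::euclidean_space \<Rightarrow> real"
  assumes "continuous_on (closed_segment p q) f"
    and f': "\<And>y. y \<in> open_segment p q \<Longrightarrow> (f has_derivative f' y) (at y)"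
    and bd: "\<And>y v. y \<in> open_segment p q \<Longrightarrow> \<bar>f' y v\<bar> \<le> C * norm v"
  shows "\<bar>f q - f p\<bar> \<le> C * norm (q - p)"
proof (cases "p = q")
  case False
  define g where "g s = f (p + s *\<^sub>R (q - p))" for s :: real
  have seg: "p + s *\<^sub>R (q - p) \<in> open_segment p q" if "0 < s" "s < 1" for s
    using that False by (auto simp: in_segment algebra_simps intro!: exI[of _ s])
  have "continuous_on {0..1} g"
    unfolding g_def
    by (rule continuous_on_compose2[OF assms(1)])
       (force simp: in_segment algebra_simps intro!: continuous_intros)+
  moreover have "(g has_derivative (\<lambda>h. f' (p + s *\<^sub>R (q - p)) (h *\<^sub>R (q - p)))) (at s)"
    if "0 < s" "s < 1" for s
    unfolding g_def
    by (rule has_derivative_compose[of "\<lambda>s. p + s *\<^sub>R (q - p)" "\<lambda>h. h *\<^sub>R (q - p)" s UNIV f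
              "f' (p + s *\<^sub>R (q - p))", OF _ f'[OF seg[OF that]]])
       (auto intro!: derivative_eq_intros)
  ultimately obtain s where s: "0 < s" "s < 1"
    "g 1 - g 0 = f' (p + s *\<^sub>R (q - p)) ((1 - 0) *\<^sub>R (q - p))"
    using mvt[of 0 1 g "\<lambda>s h. f' (p + s *\<^sub>R (q - p)) (h *\<^sub>R (q - p))"] by auto
  then show ?thesis using bd[OF seg[OF s(1,2)], of "q - p"] by (simp add: g_def)
qed simp

text \<open>Join \<open>p\<close> to \<open>q\<close> through \<open>p \<plusminus> 4 |p - q| w\<close>, with the sign chosen so that this point is in \<open>K\<close>:
  each leg is so close to the direction of \<open>w\<close> that it meets \<open>M\<close> at most once.\<close>

lemma transversal_lipschitz:
  fixes f :: "'a::euclidean_space \<Rightarrow> real"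
  assumes t: "transversal M x w r"
    and fr: "frontier K \<inter> ball x r \<subseteq> M" and KM: "K \<inter> M = {}"
    and cont: "continuous_on (K \<union> M) f"
    and f': "\<And>y. y \<in> K \<inter> ball x r \<Longrightarrow> (f has_derivative f' y) (at y)"
    and bd: "\<And>y v. y \<in> K \<inter> ball x r \<Longrightarrow> \<bar>f' y v\<bar> \<le> C * norm v"
    and pq: "p \<in> K \<inter> ball x (r / 10)" "q \<in> K \<inter> ball x (r / 10)"
  shows "\<bar>f p - f q\<bar> \<le> 9 * C * norm (p - q)"
proof (cases "p = q")
  case False
  have w: "norm w = 1" "r > 0" "w \<bullet> w = 1" using t by (auto simp: transversal_def dot_square_norm)
  define d where "d = norm (p - q)"
  have "d > 0" using False by (simp add: d_def)
  \<comment> \<open>With \<open>p\<close> and \<open>q\<close> within \<open>r / 10\<close> of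
    \<open>x\<close>, their distance \<open>d\<close> is below \<open>r / 5\<close>, so a detour of
    length \<open>4 * d\<close> from \<open>p\<close> stays inside the ball of radius
    \<open>r\<close>.\<close>
  have dr: "norm (x - p) < r / 10" "norm (x - q) < r / 10" using pq by (auto simp: dist_norm)
  have "p - q = (x - q) - (x - p)" by simp
  then have "norm (p - q) \<le> norm (x - q) + norm (x - p)" by (metis norm_triangle_ineq4)
  then have d: "d < r / 5" unfolding d_def using dr by linarith
  have in_ball: "p + s *\<^sub>R w \<in> ball x r" if "\<bar>s\<bar> \<le> 4 * d" for s
  proof -
    have "norm (x - (p + s *\<^sub>R w)) \<le> norm (x - p) + norm (s *\<^sub>R w)"
      by (metis diff_diff_eq norm_triangle_ineq4)
    then show ?thesis using that dr d w by (simp add: dist_norm)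
  qed
  have "p + (4 * d) *\<^sub>R w \<in> K \<or> p - (4 * d) *\<^sub>R w \<in> K"
  proof (rule transversal_step[OF t _ fr KM])
    show "p + (4 * d) *\<^sub>R w \<in> ball x r" "p - (4 * d) *\<^sub>R w \<in> ball x r"
      using in_ball[of "4 * d"] in_ball[of "- (4 * d)"] \<open>d > 0\<close> by auto
  qed (use pq w \<open>d > 0\<close> in \<open>auto simp: abs_mult\<close>)
  then obtain s where s: "\<bar>s\<bar> = 4 * d" "p + s *\<^sub>R w \<in> K"
  proof
    assume "p + (4 * d) *\<^sub>R w \<in> K" then show ?thesis using that[of "4 * d"] \<open>d > 0\<close> by simp
  next
    assume "p - (4 * d) *\<^sub>R w \<in> K" then show ?thesis using that[of "- (4 * d)"] \<open>d > 0\<close> by simp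
  qed
  define m where "m = p + s *\<^sub>R w"
  have m: "m \<in> K" "m \<in> ball x r" using s in_ball by (auto simp: m_def)
  have seg: "\<bar>f b - f a\<bar> \<le> C * norm (b - a)"
    if a: "a \<in> K" "a \<in> ball x r" and b: "b \<in> K" "b \<in> ball x r" and v: "norm (b - a) < 2 * \<bar>(b - a) \<bullet> w\<bar>" for a b
  proof -
    obtain z where z: "z \<in> closed_segment a b" "open_segment a z \<subseteq> K" "open_segment z b \<subseteq> K" "z \<in> K \<union> M"
      using transversal_segment[OF t v fr a b] .
    have ball: "closed_segment a b \<subseteq> ball x r" using a b by (intro closed_segment_subset convex_ball)
    have sb: "closed_segment a z \<subseteq> closed_segment a b" "closed_segment z b \<subseteq> closed_segment a b"
      using z by (auto simp: subset_closed_segment)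
    have part: "\<bar>f q - f p\<bar> \<le> C * norm (q - p)"
      if "open_segment p q \<subseteq> K" "p \<in> K \<union> M" "q \<in> K \<union> M" "closed_segment p q \<subseteq> closed_segment a b" for p q
    proof (rule segment_derivative_bound)
      show "continuous_on (closed_segment p q) f"
        by (rule continuous_on_subset[OF cont]) (use that in \<open>auto simp: closed_segment_eq_open\<close>)
      fix y assume "y \<in> open_segment p q"
      then have "y \<in> K \<inter> ball x r" using that ball by (auto simp: open_segment_def)
      then show "(f has_derivative f' y) (at y)" "\<And>v. \<bar>f' y v\<bar> \<le> C * norm v" using f' bd by auto
    qed
    have "\<bar>f z - f a\<bar> \<le> C * norm (z - a)" "\<bar>f b - f z\<bar> \<le> C * norm (b - z)"
      using z a b sb by (auto intro!: part)
    moreover have "norm (z - a) + norm (b - z) = norm (b - a)"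
      using z(1) between_mem_segment[of a b z] by (simp add: between dist_norm norm_minus_commute)
    then have "C * norm (z - a) + C * norm (b - z) = C * norm (b - a)" by (metis distrib_left)
    ultimately show ?thesis by linarith
  qed
  have pqw: "\<bar>(p - q) \<bullet> w\<bar> \<le> d" unfolding d_def by (metis Cauchy_Schwarz_ineq2 mult.right_neutral w(1))
  have mp: "m - p = s *\<^sub>R w" and mq: "m - q = (p - q) + s *\<^sub>R w" by (auto simp: m_def)
  have n1: "norm (m - p) = 4 * d" using s w by (simp add: mp)
  \<comment> \<open>The leg from \<open>q\<close> has length at most \<open>5 * d\<close> and
    component at least \<open>3 * d\<close> along \<open>w\<close>; as 5 < 2 * 3, its direction is
    admissible. The two legs together give the factor 4 + 5 = 9.\<close>
  have n2: "norm (m - q) \<le> 5 * d"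
    using norm_triangle_ineq[of "p - q" "s *\<^sub>R w"] s w by (simp add: mq d_def)
  have "\<bar>(m - q) \<bullet> w\<bar> \<ge> 3 * d" using pqw s w(3) by (simp add: mq inner_add_left)
  then have v2: "norm (m - q) < 2 * \<bar>(m - q) \<bullet> w\<bar>" using n2 \<open>d > 0\<close> by linarith
  have v1: "norm (m - p) < 2 * \<bar>(m - p) \<bullet> w\<bar>" using n1 s w \<open>d > 0\<close> by (simp add: mp)
  have pr: "p \<in> K" "p \<in> ball x r" "q \<in> K" "q \<in> ball x r" using pq w(2) by auto
  have "C \<ge> 0" using order_trans[OF abs_ge_zero bd[of p w]] w pr by simp
  then have "C * norm (m - q) \<le> C * (5 * d)" using n2 by (rule mult_left_mono[rotated])
  then show ?thesis
    using seg[OF pr(1,2) m v1] seg[OF pr(3,4) m v2] n1 unfolding d_def by (simp add: algebra_simps)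
qed simp

section \<open>Functions on spherical domains\<close>

text \<open>Compares increments along a short multiple of \<open>v\<close>. It later converts the
  Lipschitz bound on a gradient into a bound on second derivatives.\<close>

lemma lipschitz_derivative_bound:
  fixes F :: "'a::real_normed_vector \<Rightarrow> 'b::real_normed_vector"
  assumes F: "(F has_derivative F') (at y)" and T: "open T" "y \<in> T"
    and lip: "\<And>z. z \<in> T \<Longrightarrow> norm (F z - F y) \<le> C * norm (z - y)"
  shows "norm (F' v) \<le> C * norm v"
proof (cases "v = 0")
  case True
  then show ?thesis using F by (simp add: has_derivative_bounded_linear linear_simps(3))
next
  case False
  interpret F': bounded_linear F' using F by (rule has_derivative_bounded_linear)
  obtain r where r: "r > 0" "ball y r \<subseteq> T" using T open_contains_ball by blast
  have "norm (F' v) \<le> C * norm v + e" if "e > 0" for e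
  proof -
    have "e / norm v > 0" using False that by simp
    then obtain d where d: "d > 0"
      "\<And>z. norm (z - y) < d \<Longrightarrow> norm (F z - F y - F' (z - y)) \<le> e / norm v * norm (z - y)"
      using F unfolding has_derivative_within_alt by (metis UNIV_I)
    define s where "s = min d r / (2 * norm v)"
    have s: "s > 0" using d r False by (simp add: s_def)
    have "s * norm v = min d r / 2" using False by (simp add: s_def)
    then have sv: "s * norm v < d" "s * norm v < r" using d r by auto
    define z where "z = y + s *\<^sub>R v"
    have zy: "z - y = s *\<^sub>R v" "norm (z - y) = s * norm v" using s by (auto simp: z_def)
    have "norm (F z - F y) \<le> C * norm (z - y)"
      using r(2) zy sv by (intro lip) (auto simp: dist_norm norm_minus_commute[of y] simp del: norm_scaleR)
    moreover have "norm (F z - F y - F' (z - y)) \<le> e / norm v * norm (z - y)"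
      using zy(2) sv(1) by (intro d(2)) linarith
    moreover have "F' (z - y) = (F z - F y) - (F z - F y - F' (z - y))" by simp
    then have "norm (F' (z - y)) \<le> norm (F z - F y) + norm (F z - F y - F' (z - y))"
      by (metis norm_triangle_ineq4)
    ultimately have "norm (F' (z - y)) \<le> C * norm (z - y) + e / norm v * norm (z - y)" by linarith
    then have "s * norm (F' v) \<le> s * (C * norm v + e)"
      unfolding zy using s False by (simp add: F'.scaleR algebra_simps)
    then show ?thesis using s by simp
  qed
  then show ?thesis by (rule field_le_epsilon)
qed

text \<open>The inequality passes to limits of sequences from \<open>S\<close>. This carries
  estimates from \<Omega> to the boundary part \<open>V1\<close>.\<close>

lemma lipschitz_on_extend:
  fixes f :: "'a::metric_space \<Rightarrow> 'b::metric_space"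
  assumes L: "L-lipschitz_on S f" and A: "S \<subseteq> A" "A \<subseteq> closure S" and f: "continuous_on A f"
  shows "L-lipschitz_on A f"
proof (rule lipschitz_onI)
  fix x y assume xy: "x \<in> A" "y \<in> A"
  obtain a b where a: "\<And>n. a n \<in> S" "a \<longlonglongrightarrow> x" and b: "\<And>n. b n \<in> S" "b \<longlonglongrightarrow> y"
    using subsetD[OF A(2) xy(1)] subsetD[OF A(2) xy(2)] unfolding closure_sequential by blast
  have "(\<lambda>n. f (a n)) \<longlonglongrightarrow> f x" "(\<lambda>n. f (b n)) \<longlonglongrightarrow> f y"
    using continuous_on_tendsto_compose[OF f a(2) xy(1)] continuous_on_tendsto_compose[OF f b(2) xy(2)] a(1) b(1) A(1)
    by (simp_all add: subset_iff)
  then have "(\<lambda>n. dist (f (a n)) (f (b n))) \<longlonglongrightarrow> dist (f x) (f y)" by (rule tendsto_dist)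
  moreover have "(\<lambda>n. L * dist (a n) (b n)) \<longlonglongrightarrow> L * dist x y"
    using a b by (intro tendsto_intros)
  moreover have "dist (f (a n)) (f (b n)) \<le> L * dist (a n) (b n)" for n
    using L a b by (blast intro: lipschitz_onD)
  ultimately show "dist (f x) (f y) \<le> L * dist x y"
    using LIMSEQ_le by blast
qed (use L lipschitz_on_nonneg in blast)

lemma lipschitz_on_imp_bounded:
  fixes f :: "'a::heine_borel \<Rightarrow> 'b::heine_borel"
  assumes "L-lipschitz_on S f" "bounded S"
  shows "bounded (f ` S)"
  using bounded_uniformly_continuous_image[OF lipschitz_on_uniformly_continuous[OF assms(1)] assms(2)] .

lemma lipschitz_on_scaleR:
  fixes f :: "'a::heine_borel \<Rightarrow> real" and g :: "'a \<Rightarrow> 'b::euclidean_space"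
  assumes f: "L-lipschitz_on S f" and g: "L'-lipschitz_on S g" and S: "bounded S"
  shows "\<exists>K. K-lipschitz_on S (\<lambda>x. f x *\<^sub>R g x)"
proof -
  obtain B where B: "\<And>x. x \<in> S \<Longrightarrow> norm (f x) \<le> B" "B > 0"
    using lipschitz_on_imp_bounded[OF f S] bounded_pos by (metis imageI)
  obtain B' where B': "\<And>x. x \<in> S \<Longrightarrow> norm (g x) \<le> B'" "B' > 0"
    using lipschitz_on_imp_bounded[OF g S] bounded_pos by (metis imageI)
  have "(B * L' + B' * L)-lipschitz_on S (\<lambda>x. f x *\<^sub>R g x)"
  proof (rule lipschitz_onI)
    fix x y assume xy: "x \<in> S" "y \<in> S"
    have "f x *\<^sub>R g x - f y *\<^sub>R g y = f x *\<^sub>R (g x - g y) + (f x - f y) *\<^sub>R g y"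
      by (simp add: algebra_simps)
    then have "norm (f x *\<^sub>R g x - f y *\<^sub>R g y) \<le> norm (f x) * norm (g x - g y) + norm (f x - f y) * norm (g y)"
      by (metis norm_scaleR norm_triangle_ineq real_norm_def)
    also have "\<dots> \<le> B * (L' * dist x y) + (L * dist x y) * B'"
    proof (intro add_mono mult_mono)
      show "norm (g x - g y) \<le> L' * dist x y" using lipschitz_onD[OF g xy] by (simp add: dist_norm)
      show "norm (f x - f y) \<le> L * dist x y" using lipschitz_onD[OF f xy] by (simp add: dist_norm)
    qed (use B B' xy lipschitz_on_nonneg[OF f] lipschitz_on_nonneg[OF g] in auto)
    finally show "dist (f x *\<^sub>R g x) (f y *\<^sub>R g y) \<le> (B * L' + B' * L) * dist x y"
      by (simp add: dist_norm algebra_simps)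
  qed (use B B' lipschitz_on_nonneg[OF f] lipschitz_on_nonneg[OF g] in auto)
  then show ?thesis by blast
qed

lemma has_derivative_hext_scaleR:
  assumes "(hext f has_derivative D) (at y)" "c > 0"
  shows "(hext f has_derivative (\<lambda>v. D (v /\<^sub>R c))) (at (c *\<^sub>R y))"
proof -
  have "hext f = (\<lambda>z. hext f (z /\<^sub>R c))" using assms(2) by (auto simp: hext_scaleR)
  moreover have "((\<lambda>z. hext f (z /\<^sub>R c)) has_derivative (\<lambda>v. D (v /\<^sub>R c))) (at (c *\<^sub>R y))"
    by (rule has_derivative_compose[of "\<lambda>z. z /\<^sub>R c" "\<lambda>z. z /\<^sub>R c"])
       (use assms in \<open>auto intro!: derivative_eq_intros\<close>)
  ultimately show ?thesis by simp
qed

lemma sgrad_inner: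
  fixes f :: "'a::euclidean_space \<Rightarrow> real"
  assumes "frechet_derivative (hext f) (at x within scone A) = D" "linear D"
  shows "sgrad f A x \<bullet> v = D v"
proof -
  have "D v = D (\<Sum>b\<in>Basis. (v \<bullet> b) *\<^sub>R b)" by (simp add: euclidean_representation)
  also have "\<dots> = (\<Sum>b\<in>Basis. (v \<bullet> b) * D b)"
    using assms(2) by (simp add: linear_sum linear_cmul)
  finally show ?thesis
    by (simp add: sgrad_def assms inner_sum_left inner_commute[of v] mult.commute)
qed

section \<open>Calculus on the cone over a spherical domain\<close>

locale sphere_domain =
  fixes \<Omega> V1 V2 :: "'a::euclidean_space set"
  assumes dom_sub: "\<Omega> \<subseteq> sphere 0 1"
    and dom_open: "openin (top_of_set (sphere 0 1)) \<Omega>"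
    and bdry: "closure \<Omega> - \<Omega> = V1 \<union> V2"
    and disj: "V1 \<inter> V2 = {}"
    and V1: "compact_submanifold_of_sphere V1"
    and V2: "compact_submanifold_of_sphere V2"
begin

lemma closure_sub_sphere: "closure \<Omega> \<subseteq> sphere 0 1"
  using dom_sub by (rule closure_minimal) simp

lemma compact_closure: "compact (closure \<Omega>)"
  using closure_sub_sphere bounded_subset[OF bounded_sphere] by (simp add: compact_eq_bounded_closed)

lemma bounded_dom: "bounded \<Omega>"
  using dom_sub bounded_subset[OF bounded_sphere] by blast

lemma dom_V1_subset_closure: "\<Omega> \<union> V1 \<subseteq> closure \<Omega>"
  using bdry closure_subset[of \<Omega>] by blast

lemma dom_V1_norm: "x \<in> \<Omega> \<union> V1 \<Longrightarrow> norm x = 1"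
  using dom_V1_subset_closure closure_sub_sphere by fastforce

lemma open_scone_dom: "open (scone \<Omega>)"
  using dom_open by (rule open_scone)

text \<open>The apex has to be removed: it is a limit of points of any nonempty cone, while
  \<open>scone\<close> excludes it.\<close>

lemma closure_scone: "closure (scone \<Omega>) - {0} = scone (closure \<Omega>)"
proof (intro equalityI subsetI)
  fix z assume z: "z \<in> closure (scone \<Omega>) - {0}"
  then obtain s where s: "\<And>n. s n \<in> scone \<Omega>" "s \<longlonglongrightarrow> z" using closure_sequential by blast
  have "(\<lambda>n. s n /\<^sub>R norm (s n)) \<longlonglongrightarrow> z /\<^sub>R norm z"
    using s z by (intro tendsto_intros) auto
  moreover have "s n /\<^sub>R norm (s n) \<in> \<Omega>" for n using s by (simp add: scone_def)
  ultimately have "z /\<^sub>R norm z \<in> closure \<Omega>"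
    unfolding closure_sequential by (intro exI[of _ "\<lambda>n. s n /\<^sub>R norm (s n)"]) blast
  then show "z \<in> scone (closure \<Omega>)" using z by (simp add: scone_def)
next
  fix z assume z: "z \<in> scone (closure \<Omega>)"
  then obtain s where s: "\<And>n. s n \<in> \<Omega>" "s \<longlonglongrightarrow> z /\<^sub>R norm z"
    by (auto simp: scone_def closure_sequential)
  have "z \<noteq> 0" using z by (simp add: scone_def)
  then have "norm z *\<^sub>R s n \<in> scone \<Omega>" for n
    using s(1) sphere_subset_scone[OF dom_sub] by (simp add: scone_scaleR subset_iff)
  moreover have "(\<lambda>n. norm z *\<^sub>R s n) \<longlonglongrightarrow> norm z *\<^sub>R (z /\<^sub>R norm z)"
    using s by (intro tendsto_intros)
  ultimately have "norm z *\<^sub>R (z /\<^sub>R norm z) \<in> closure (scone \<Omega>)"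
    unfolding closure_sequential by (intro exI[of _ "\<lambda>n. norm z *\<^sub>R s n"]) blast
  then show "z \<in> closure (scone \<Omega>) - {0}"
    using \<open>z \<noteq> 0\<close> by simp
qed

text \<open>The bound \<open>norm x / 2\<close> on the radius keeps the ball away from the apex, a
  frontier point of a nonempty cone that does not come from the boundary of \<Omega>.\<close>

lemma local_transversal:
  assumes x: "x \<in> scone (closure \<Omega>)"
  obtains w r where "transversal (scone (closure \<Omega> - \<Omega>)) x w r" "r \<le> norm x / 2"
    "frontier (scone \<Omega>) \<inter> ball x r \<subseteq> scone (closure \<Omega> - \<Omega>)"
proof -
  obtain w r where t: "transversal (scone (closure \<Omega> - \<Omega>)) x w r"
    using scone_frontier_transversal[OF dom_sub dom_open bdry disj V1 V2 x] .
  have "x \<noteq> 0" using x by (simp add: scone_def)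
  have "transversal (scone (closure \<Omega> - \<Omega>)) x w (min r (norm x / 2))"
    by (rule transversal_mono[OF t]) (use t \<open>x \<noteq> 0\<close> in \<open>auto simp: transversal_def\<close>)
  moreover have "frontier (scone \<Omega>) \<inter> ball x (min r (norm x / 2)) \<subseteq> scone (closure \<Omega> - \<Omega>)"
  proof
    fix z assume z: "z \<in> frontier (scone \<Omega>) \<inter> ball x (min r (norm x / 2))"
    then have "z \<noteq> 0" using \<open>x \<noteq> 0\<close> by auto
    then have "z \<in> scone (closure \<Omega>)" "z \<notin> scone \<Omega>"
      using z closure_scone open_scone_dom by (auto simp: frontier_def interior_open)
    then show "z \<in> scone (closure \<Omega> - \<Omega>)" by (auto simp: scone_def)
  qed
  ultimately show ?thesis using that[of w "min r (norm x / 2)"] by simp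
qed

lemma derivative_unique:
  fixes f :: "'a \<Rightarrow> 'b::real_normed_vector"
  assumes x: "x \<in> scone (\<Omega> \<union> V1)"
    and D: "(f has_derivative D1) (at x within scone (\<Omega> \<union> V1))"
      "(f has_derivative D2) (at x within scone (\<Omega> \<union> V1))"
  shows "D1 = D2"
proof -
  have x': "x \<in> scone (closure \<Omega>)" using x dom_V1_subset_closure by (auto simp: scone_def)
  obtain w r where "transversal (scone (closure \<Omega> - \<Omega>)) x w r"
    "frontier (scone \<Omega>) \<inter> ball x r \<subseteq> scone (closure \<Omega> - \<Omega>)"
    using local_transversal[OF x'] .
  moreover have "scone \<Omega> \<inter> scone (closure \<Omega> - \<Omega>) = {}" "scone \<Omega> \<subseteq> scone (\<Omega> \<union> V1)"
    by (auto simp: scone_def)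
  moreover have "x \<in> closure (scone \<Omega>)" using x' closure_scone by blast
  ultimately show ?thesis using transversal_has_derivative_unique D by blast
qed

text \<open>\<open>frechet_derivative\<close> picks some derivative, so at points of
  \<open>V1\<close> its value can be computed only because the derivative within the cone is
  unique.\<close>

lemma frechet_derivative_eq:
  fixes f :: "'a \<Rightarrow> 'b::real_normed_vector"
  assumes "x \<in> scone (\<Omega> \<union> V1)" "(f has_derivative D) (at x within scone (\<Omega> \<union> V1))"
  shows "frechet_derivative f (at x within scone (\<Omega> \<union> V1)) = D"
  using derivative_unique[OF assms(1)] assms(2) frechet_derivative_works differentiable_def by blast

lemma sgrad_eqI:
  assumes "y \<in> \<Omega>" "(hext f has_derivative (\<lambda>v. a \<bullet> v)) (at y)"
  shows "sgrad f \<Omega> y = a"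
proof -
  have "y \<in> scone \<Omega>" using assms sphere_subset_scone[OF dom_sub] by blast
  then have "frechet_derivative (hext f) (at y within scone \<Omega>) = (\<lambda>v. a \<bullet> v)"
    using frechet_derivative_at[OF assms(2)] open_scone_dom by (simp only: at_within_open)
  from sgrad_inner[OF this] show ?thesis
    by (simp add: bounded_linear.linear bounded_linear_inner_right) (metis inner_commute vector_eq_rdot)
qed

text \<open>The extension is 0-homogeneous, so its Euclidean gradient is homogeneous of degree -1;
  hence the division by \<open>norm y\<close>.\<close>

lemma has_derivative_hext:
  assumes diff: "\<And>y. y \<in> \<Omega> \<Longrightarrow> hext f differentiable at y" and y: "y \<in> scone \<Omega>"
  shows "(hext f has_derivative (\<lambda>v. (sgrad f \<Omega> (y /\<^sub>R norm y) /\<^sub>R norm y) \<bullet> v)) (at y)"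
proof -
  have y': "y /\<^sub>R norm y \<in> \<Omega>" "y \<noteq> 0" using y by (auto simp: scone_def)
  obtain D where D: "(hext f has_derivative D) (at (y /\<^sub>R norm y))"
    using diff[OF y'(1)] by (auto simp: differentiable_def)
  have "linear D" using D has_derivative_linear by blast
  moreover have "y /\<^sub>R norm y \<in> scone \<Omega>" using y' sphere_subset_scone[OF dom_sub] by blast
  then have "frechet_derivative (hext f) (at (y /\<^sub>R norm y) within scone \<Omega>) = D"
    using frechet_derivative_at[OF D] open_scone_dom by (simp only: at_within_open)
  ultimately have "D = (\<lambda>v. sgrad f \<Omega> (y /\<^sub>R norm y) \<bullet> v)"
    using sgrad_inner by (metis (no_types))
  with has_derivative_hext_scaleR[OF D, of "norm y"] y'(2) show ?thesis
    by simp
qed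

text \<open>\<open>c11_closure\<close> provides a Lipschitz gradient but only continuity for the
  function itself. The local crossing estimate applies at each point of the closure, and compactness
  makes it uniform.\<close>

lemma c11_closure_lipschitz:
  assumes diff: "\<And>y. y \<in> \<Omega> \<Longrightarrow> hext f differentiable at y" and c11: "c11_closure \<Omega> f"
  shows "\<exists>L. L-lipschitz_on \<Omega> f"
proof -
  obtain F G where F: "continuous_on (closure \<Omega>) F" "\<And>x. x \<in> \<Omega> \<Longrightarrow> F x = f x"
    and G: "continuous_on (closure \<Omega>) G" "\<And>x. x \<in> \<Omega> \<Longrightarrow> G x = sgrad f \<Omega> x"
    using c11 unfolding c11_closure_def by blast
  obtain S where S: "S > 0" "\<And>x. x \<in> closure \<Omega> \<Longrightarrow> norm (F x) \<le> S"
    using compact_imp_bounded[OF compact_continuous_image[OF F(1) compact_closure]] bounded_pos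
    by (metis imageI)
  obtain B where B: "B > 0" "\<And>x. x \<in> closure \<Omega> \<Longrightarrow> norm (G x) \<le> B"
    using compact_imp_bounded[OF compact_continuous_image[OF G(1) compact_closure]] bounded_pos
    by (metis imageI)
  define K where "K = scone \<Omega>"
  define M where "M = scone (closure \<Omega> - \<Omega>)"
  define f' where "f' y v = (sgrad f \<Omega> (y /\<^sub>R norm y) /\<^sub>R norm y) \<bullet> v" for y v
  have KM: "K \<inter> M = {}" "K \<union> M = scone (closure \<Omega>)"
    using closure_subset[of \<Omega>] by (auto simp: K_def M_def scone_def)
  \<comment> \<open>The extension \<open>F\<close> is used instead of \<open>f\<close> because a
    crossing path also visits points of the cone over the boundary.\<close>
  have cont: "continuous_on (K \<union> M) (hext F)"
    unfolding hext_def KM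
    by (rule continuous_on_compose2[OF F(1)]) (auto simp: scone_def intro!: continuous_intros)
  have f': "(hext F has_derivative f' y) (at y)" if "y \<in> K" for y
  proof (rule has_derivative_transform_within_open)
    show "(hext f has_derivative f' y) (at y)"
      unfolding f'_def using diff that unfolding K_def by (rule has_derivative_hext)
    show "open K" by (simp add: K_def open_scone_dom)
  qed (use that in \<open>auto simp: K_def hext_def scone_def F\<close>)
  have "\<exists>r>0. \<forall>p\<in>K \<inter> ball x r. \<forall>q\<in>K \<inter> ball x r. \<bar>hext F p - hext F q\<bar> \<le> 18 * B * norm (p - q)"
    if x: "x \<in> closure \<Omega>" for x
  proof -
    have nx: "norm x = 1" using x closure_sub_sphere by auto
    then have "x \<in> scone (closure \<Omega>)" using x by (auto simp: scone_def)
    then obtain w r where t: "transversal M x w r" "r \<le> norm x / 2" "frontier K \<inter> ball x r \<subseteq> M"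
      using local_transversal unfolding K_def M_def by blast
    have "\<bar>hext F p - hext F q\<bar> \<le> 9 * (2 * B) * norm (p - q)"
      if "p \<in> K \<inter> ball x (r / 10)" "q \<in> K \<inter> ball x (r / 10)" for p q
    proof (rule transversal_lipschitz[OF t(1,3) KM(1) cont f' _ that])
      fix y v assume y: "y \<in> K \<inter> ball x r"
      then have "norm (x - y) < 1 / 2" using t(2) nx by (simp add: dist_norm)
      then have ny: "norm y > 1 / 2" using norm_triangle_ineq2[of x y] nx by linarith
      have "norm (sgrad f \<Omega> (y /\<^sub>R norm y)) \<le> B"
        using y B(2) G(2) closure_subset[of \<Omega>] by (fastforce simp: K_def scone_def)
      moreover have "inverse (norm y) \<le> 2" using le_imp_inverse_le[of "1/2" "norm y"] ny by simp
      ultimately have "inverse (norm y) * norm (sgrad f \<Omega> (y /\<^sub>R norm y)) \<le> 2 * B"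
        by (intro mult_mono) auto
      then have "norm (sgrad f \<Omega> (y /\<^sub>R norm y) /\<^sub>R norm y) \<le> 2 * B" by simp
      then show "\<bar>f' y v\<bar> \<le> 2 * B * norm v"
        unfolding f'_def by (meson Cauchy_Schwarz_ineq2 mult_right_mono norm_ge_zero order_trans)
    qed auto
    then show ?thesis using t(1) by (intro exI[of _ "r / 10"]) (auto simp: transversal_def)
  qed
  then obtain R where R: "\<And>x. x \<in> closure \<Omega> \<Longrightarrow> R x > 0"
    "\<And>x p q. x \<in> closure \<Omega> \<Longrightarrow> p \<in> K \<inter> ball x (R x) \<Longrightarrow> q \<in> K \<inter> ball x (R x) \<Longrightarrow>
       \<bar>hext F p - hext F q\<bar> \<le> 18 * B * norm (p - q)"
    by metis
  \<comment> \<open>A Lebesgue number of the cover. Below distance \<open>e\<close> the local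
    constant \<open>18 * B\<close> applies (9 times the gradient bound \<open>2 * B\<close> on
    points of norm above 1/2); beyond it the difference is at most \<open>2 * S\<close>.\<close>
  obtain e where e: "e > 0" "\<And>x. x \<in> closure \<Omega> \<Longrightarrow> \<exists>G\<in>(\<lambda>x. ball x (R x)) ` closure \<Omega>. ball x e \<subseteq> G"
    by (rule Heine_Borel_lemma[OF compact_closure, of "(\<lambda>x. ball x (R x)) ` closure \<Omega>"])
       (use R(1) in force)+
  have "(18 * B + 2 * S / e)-lipschitz_on \<Omega> f"
  proof (rule lipschitz_onI)
    fix p q assume pq: "p \<in> \<Omega>" "q \<in> \<Omega>"
    have pqK: "p \<in> K" "q \<in> K" using pq sphere_subset_scone[OF dom_sub] by (auto simp: K_def)
    have hF: "hext F p = f p" "hext F q = f q" using pq dom_sub by (auto simp: hext_def F(2))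
    have pqc: "p \<in> closure \<Omega>" "q \<in> closure \<Omega>" using pq closure_subset by auto
    show "dist (f p) (f q) \<le> (18 * B + 2 * S / e) * dist p q"
    proof (cases "dist p q < e")
      case True
      obtain x where "x \<in> closure \<Omega>" "ball p e \<subseteq> ball x (R x)" using e(2)[OF pqc(1)] by blast
      then have "dist (f p) (f q) \<le> 18 * B * dist p q"
        using R(2)[of x p q] True pqK e(1) by (auto simp: hF dist_norm subset_iff)
      also have "\<dots> \<le> (18 * B + 2 * S / e) * dist p q"
        using S e by (intro mult_right_mono) auto
      finally show ?thesis .
    next
      case False
      have "dist (f p) (f q) \<le> 2 * S"
        using S(2)[OF pqc(1)] S(2)[OF pqc(2)] pq by (simp add: F dist_real_def)
      also have "\<dots> = 2 * S / e * e" using e by simp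
      also have "\<dots> \<le> (18 * B + 2 * S / e) * dist p q"
        using False S e B by (intro mult_mono) auto
      finally show ?thesis .
    qed
  qed (use B S e in auto)
  then show ?thesis by blast
qed

text \<open>For differentiable \<open>f\<close> the quantity estimated is the Euclidean gradient of
  \<open>hext f\<close>. It must be Lipschitz in the ambient space, off the sphere as well, since
  \<open>shess\<close> is a Euclidean second derivative; the bound \<open>1/2\<close> keeps the apex
  away.\<close>

lemma scaled_sgrad_lipschitz:
  assumes c11: "c11_closure \<Omega> f"
  obtains C where "C > 0" "\<And>y z. y \<in> scone \<Omega> \<Longrightarrow> z \<in> scone \<Omega> \<Longrightarrow> norm y \<ge> 1/2 \<Longrightarrow> norm z \<ge> 1/2 \<Longrightarrow>
    norm (sgrad f \<Omega> (y /\<^sub>R norm y) /\<^sub>R norm y - sgrad f \<Omega> (z /\<^sub>R norm z) /\<^sub>R norm z) \<le> C * norm (y - z)"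
proof -
  obtain L where L: "L-lipschitz_on \<Omega> (sgrad f \<Omega>)" using c11 unfolding c11_closure_def by blast
  obtain B where B: "B > 0" "\<And>x. x \<in> \<Omega> \<Longrightarrow> norm (sgrad f \<Omega> x) \<le> B"
    using lipschitz_on_imp_bounded[OF L bounded_dom] bounded_pos by (metis imageI)
  have "norm (sgrad f \<Omega> (y /\<^sub>R norm y) /\<^sub>R norm y - sgrad f \<Omega> (z /\<^sub>R norm z) /\<^sub>R norm z) \<le> (8 * L + 4 * B) * norm (y - z)"
    if y: "y \<in> scone \<Omega>" "norm y \<ge> 1/2" and z: "z \<in> scone \<Omega>" "norm z \<ge> 1/2" for y z
  proof -
    define a b where "a = sgrad f \<Omega> (y /\<^sub>R norm y)" and "b = sgrad f \<Omega> (z /\<^sub>R norm z)"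
    have yz: "y \<noteq> 0" "z \<noteq> 0" "y /\<^sub>R norm y \<in> \<Omega>" "z /\<^sub>R norm z \<in> \<Omega>" using y z by (auto simp: scone_def)
    have "norm (a - b) \<le> L * norm (y /\<^sub>R norm y - z /\<^sub>R norm z)"
      unfolding a_def b_def using lipschitz_on_normD[OF L yz(3,4)] .
    also have "\<dots> \<le> L * (4 * norm (y - z))"
    proof (rule mult_left_mono)
      have "1 / 2 * norm (y /\<^sub>R norm y - z /\<^sub>R norm z) \<le> norm y * norm (y /\<^sub>R norm y - z /\<^sub>R norm z)"
        using y by (intro mult_right_mono) auto
      then show "norm (y /\<^sub>R norm y - z /\<^sub>R norm z) \<le> 4 * norm (y - z)"
        using norm_sgn_diff_le[OF yz(1,2)] by linarith
    qed (rule lipschitz_on_nonneg[OF L])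
    finally have ab: "norm (a - b) \<le> 4 * L * norm (y - z)" by simp
    have nb: "norm b \<le> B" using B yz by (simp add: b_def)
    have iy: "inverse (norm y) \<le> 2" "inverse (norm z) \<le> 2"
      using y z yz by (auto simp: field_simps)
    have "inverse (norm y) - inverse (norm z) = (norm z - norm y) * (inverse (norm y) * inverse (norm z))"
      using yz by (simp add: field_simps)
    then have "\<bar>inverse (norm y) - inverse (norm z)\<bar> = \<bar>norm z - norm y\<bar> * (inverse (norm y) * inverse (norm z))"
      by (simp add: abs_mult)
    also have "\<dots> \<le> norm (y - z) * (2 * 2)"
      using iy norm_triangle_ineq3[of z y] by (intro mult_mono) (auto simp: norm_minus_commute)
    finally have i: "\<bar>inverse (norm y) - inverse (norm z)\<bar> \<le> 4 * norm (y - z)" by simp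
    have "a /\<^sub>R norm y - b /\<^sub>R norm z = inverse (norm y) *\<^sub>R (a - b) + (inverse (norm y) - inverse (norm z)) *\<^sub>R b"
      by (simp add: algebra_simps)
    also have "norm \<dots> \<le> inverse (norm y) * norm (a - b) + \<bar>inverse (norm y) - inverse (norm z)\<bar> * norm b"
      by (rule order_trans[OF norm_triangle_ineq]) simp
    also have "\<dots> \<le> 2 * (4 * L * norm (y - z)) + 4 * norm (y - z) * B"
      using iy i ab nb by (intro add_mono mult_mono) auto
    finally show ?thesis unfolding a_def b_def by (simp add: algebra_simps)
  qed
  moreover have "8 * L + 4 * B > 0" using B lipschitz_on_nonneg[OF L] by simp
  ultimately show ?thesis using that by blast
qed

end

section \<open>The horospherical map\<close>

locale horospherical_data = sphere_domain \<Omega> V1 V2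
  for \<Omega> V1 V2 :: "'a::euclidean_space set" +
  fixes \<rho> :: "'a \<Rightarrow> real" and \<alpha> :: real
  assumes alpha: "0 < \<alpha>"
    and reg: "c2alpha_on \<alpha> (\<Omega> \<union> V1) \<rho>"
    and h1: "c11_closure \<Omega> (\<lambda>x. (exp (- \<rho> x))\<^sup>2)"
    and h2: "\<exists>L. L-lipschitz_on \<Omega> (\<lambda>x. (norm (sgrad (\<lambda>y. exp (- \<rho> y)) \<Omega> x))\<^sup>2)"
begin

text \<open>Makes \<open>c2alpha_on\<close> usable up to \<open>V1\<close>: uniqueness identifies
  the derivative within the cone with \<open>g1\<close>, whatever the shift \<open>t\<close>, and
  the Hoelder bound gives continuity of \<open>g2\<close> at \<open>x\<close>.\<close>

lemma local_C2_extension: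
  assumes x: "x \<in> \<Omega> \<union> V1"
  obtains r g g1 g2 where "r > 0" "r \<le> 1/2"
    "\<And>y. y \<in> ball x r \<Longrightarrow> (g has_derivative g1 y) (at y)"
    "\<And>y u. y \<in> ball x r \<Longrightarrow> ((\<lambda>z. g1 z u) has_derivative g2 y u) (at y)"
    "\<And>u. isCont (\<lambda>y. g2 y u u) x"
    "\<And>y. y \<in> ball x r \<Longrightarrow> y \<in> scone (\<Omega> \<union> V1) \<Longrightarrow> g y = hext \<rho> y"
    "\<And>y t. y \<in> ball x r \<Longrightarrow> y \<in> scone (\<Omega> \<union> V1) \<Longrightarrow>
       frechet_derivative (hext (\<lambda>x. \<rho> x + t)) (at y within scone (\<Omega> \<union> V1)) = g1 y"
proof -
  obtain r0 g g1 g2 C where r0: "r0 > 0"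
    and g1: "\<forall>y\<in>ball x r0. (g has_derivative g1 y) (at y)"
    and g2: "\<forall>y\<in>ball x r0. \<forall>u. ((\<lambda>z. g1 z u) has_derivative g2 y u) (at y)"
    and C: "\<forall>y\<in>ball x r0. \<forall>z\<in>ball x r0. \<forall>u v.
          \<bar>g2 y u v - g2 z u v\<bar> \<le> C * norm u * norm v * dist y z powr \<alpha>"
    and g: "\<forall>y\<in>ball x r0 \<inter> scone (\<Omega> \<union> V1). g y = hext \<rho> y"
    using reg x unfolding c2alpha_on_def by blast
  define r where "r = min r0 (1/2)"
  have r: "r > 0" "r \<le> 1/2" "ball x r \<subseteq> ball x r0" using r0 by (auto simp: r_def)
  have "isCont (\<lambda>y. g2 y u u) x" for u
  proof -
    have "((\<lambda>y. g2 y u u - g2 x u u) \<longlongrightarrow> 0) (at x)"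
    proof (rule Lim_null_comparison)
      have "\<forall>\<^sub>F y in at x. y \<in> ball x r0"
        using r0 eventually_at_ball[of r0 x UNIV] by simp
      then show "\<forall>\<^sub>F y in at x. norm (g2 y u u - g2 x u u) \<le> C * norm u * norm u * dist y x powr \<alpha>"
      proof eventually_elim
        case (elim y)
        have "x \<in> ball x r0" using r0 by simp
        from C[rule_format, OF elim this, of u u] show ?case unfolding real_norm_def .
      qed
      have "((\<lambda>y. dist y x) \<longlongrightarrow> 0) (at x)" 
        using tendsto_dist[OF tendsto_ident_at[of x UNIV] tendsto_const[of x]] by simp
      then have "((\<lambda>y. dist y x powr \<alpha>) \<longlongrightarrow> 0) (at x)"
        using alpha by (intro tendsto_zero_powrI[where b = \<alpha>]) auto
      then show "((\<lambda>y. C * norm u * norm u * dist y x powr \<alpha>) \<longlongrightarrow> 0) (at x)"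
        by (rule tendsto_mult_right_zero)
    qed
    then show ?thesis unfolding isCont_def by (rule LIM_zero_cancel)
  qed
  moreover have "frechet_derivative (hext (\<lambda>x. \<rho> x + t)) (at y within scone (\<Omega> \<union> V1)) = g1 y"
    if y: "y \<in> ball x r" "y \<in> scone (\<Omega> \<union> V1)" for y t
  proof (rule frechet_derivative_eq[OF y(2)])
    obtain d where d: "d > 0" "ball y d \<subseteq> ball x r" using y(1) open_ball open_contains_ball by blast
    have gd: "(g has_derivative g1 y) (at y)" using g1 y r by blast
    have "((\<lambda>y. g y + t) has_derivative g1 y) (at y within scone (\<Omega> \<union> V1))"
      using has_derivative_add[OF has_derivative_at_withinI[OF gd] has_derivative_const] by simp
    then show "(hext (\<lambda>x. \<rho> x + t) has_derivative g1 y) (at y within scone (\<Omega> \<union> V1))"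
    proof (rule has_derivative_transform_within[OF _ d(1) y(2)])
      fix z assume "z \<in> scone (\<Omega> \<union> V1)" "dist z y < d"
      then have "z \<in> ball x r0 \<inter> scone (\<Omega> \<union> V1)" using d r by (metis IntI dist_commute mem_ball subsetD)
      then show "g z + t = hext (\<lambda>x. \<rho> x + t) z" using g by (simp add: hext_def)
    qed
  qed
  ultimately show ?thesis using that[of r g g1 g2] r g1 g2 g by blast
qed

section \<open>The gradient of \<rho> up to the boundary part \<open>V1\<close>\<close>

definition Gr :: "'a \<Rightarrow> 'a" where "Gr = sgrad \<rho> (\<Omega> \<union> V1)"

lemma dom_V1_subset_scone: "\<Omega> \<union> V1 \<subseteq> scone (\<Omega> \<union> V1)"
  using dom_V1_subset_closure closure_sub_sphere by (intro sphere_subset_scone) blast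

lemma sgrad_shift: "x \<in> \<Omega> \<union> V1 \<Longrightarrow> sgrad (\<lambda>x. \<rho> x + t) (\<Omega> \<union> V1) x = Gr x"
proof -
  assume x: "x \<in> \<Omega> \<union> V1"
  obtain r g g1 g2 where *: "r > 0" "\<And>y t. y \<in> ball x r \<Longrightarrow> y \<in> scone (\<Omega> \<union> V1) \<Longrightarrow>
       frechet_derivative (hext (\<lambda>x. \<rho> x + t)) (at y within scone (\<Omega> \<union> V1)) = g1 y"
    by (rule local_C2_extension[OF x]) blast
  have "x \<in> scone (\<Omega> \<union> V1)" "x \<in> ball x r" using x dom_V1_subset_scone *(1) by auto
  then show ?thesis unfolding Gr_def sgrad_def using *(2)[of x t] *(2)[of x 0] by simp
qed

lemma Gr_inner:
  assumes g1: "(g has_derivative g1 y) (at y)" and y: "y \<in> \<Omega> \<union> V1"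
    and fd: "\<And>t. frechet_derivative (hext (\<lambda>x. \<rho> x + t)) (at y within scone (\<Omega> \<union> V1)) = g1 y"
  shows "Gr y \<bullet> v = g1 y v"
  unfolding Gr_def using fd[of 0] has_derivative_linear[OF g1] by (intro sgrad_inner) auto

lemma continuous_Gr: "continuous_on (\<Omega> \<union> V1) Gr"
proof (unfold continuous_on_eq_continuous_within, rule ballI)
  fix x assume x: "x \<in> \<Omega> \<union> V1"
  obtain r g g1 g2 where r: "r > 0"
    and g1: "\<And>y. y \<in> ball x r \<Longrightarrow> (g has_derivative g1 y) (at y)"
    and g2: "\<And>y u. y \<in> ball x r \<Longrightarrow> ((\<lambda>z. g1 z u) has_derivative g2 y u) (at y)"
    and fd: "\<And>y t. y \<in> ball x r \<Longrightarrow> y \<in> scone (\<Omega> \<union> V1) \<Longrightarrow>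
       frechet_derivative (hext (\<lambda>x. \<rho> x + t)) (at y within scone (\<Omega> \<union> V1)) = g1 y"
    by (rule local_C2_extension[OF x]) blast
  have "continuous (at x within \<Omega> \<union> V1) (\<lambda>y. \<Sum>b\<in>Basis. g1 y b *\<^sub>R b)"
    using r by (intro continuous_sum continuous_scaleR continuous_const
      continuous_at_imp_continuous_at_within[OF has_derivative_continuous[OF g2]]) simp
  then show "continuous (at x within \<Omega> \<union> V1) Gr"
  proof (rule continuous_transform_within[OF _ r x])
    fix y assume y: "y \<in> \<Omega> \<union> V1" "dist y x < r"
    then have "Gr y \<bullet> b = g1 y b" for b
      using g1[of y] dom_V1_subset_scone by (intro Gr_inner[OF _ y(1)] fd) (auto simp: dist_commute)
    then show "(\<Sum>b\<in>Basis. g1 y b *\<^sub>R b) = Gr y"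
      by (metis (no_types, lifting) euclidean_representation sum.cong)
  qed
qed

lemma continuous_rho: "continuous_on (\<Omega> \<union> V1) \<rho>"
proof (unfold continuous_on_eq_continuous_within, rule ballI)
  fix x assume x: "x \<in> \<Omega> \<union> V1"
  obtain r g g1 g2 where r: "r > 0"
    and g1: "\<And>y. y \<in> ball x r \<Longrightarrow> (g has_derivative g1 y) (at y)"
    and g: "\<And>y. y \<in> ball x r \<Longrightarrow> y \<in> scone (\<Omega> \<union> V1) \<Longrightarrow> g y = hext \<rho> y"
    by (rule local_C2_extension[OF x]) blast
  have "continuous (at x within \<Omega> \<union> V1) g"
    using r by (intro continuous_at_imp_continuous_at_within[OF has_derivative_continuous[OF g1]]) simp
  then show "continuous (at x within \<Omega> \<union> V1) \<rho>"
  proof (rule continuous_transform_within[OF _ r x])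
    fix y assume y: "y \<in> \<Omega> \<union> V1" "dist y x < r"
    then show "g y = \<rho> y" using g[of y] dom_V1_subset_scone dom_V1_norm[OF y(1)] by (auto simp: hext_def dist_commute)
  qed
qed

text \<open>Along the ray through \<open>x\<close> the function \<open>g\<close> agrees with a
  0-homogeneous one, so its derivative in direction \<open>x\<close> is zero.\<close>

lemma Gr_tangent:
  assumes x: "x \<in> \<Omega> \<union> V1" shows "Gr x \<bullet> x = 0"
proof -
  obtain r g g1 g2 where r: "r > 0"
    and g1: "\<And>y. y \<in> ball x r \<Longrightarrow> (g has_derivative g1 y) (at y)"
    and g: "\<And>y. y \<in> ball x r \<Longrightarrow> y \<in> scone (\<Omega> \<union> V1) \<Longrightarrow> g y = hext \<rho> y"
    and fd: "\<And>y t. y \<in> ball x r \<Longrightarrow> y \<in> scone (\<Omega> \<union> V1) \<Longrightarrow>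
       frechet_derivative (hext (\<lambda>x. \<rho> x + t)) (at y within scone (\<Omega> \<union> V1)) = g1 y"
    by (rule local_C2_extension[OF x]) blast
  have xs: "x \<in> scone (\<Omega> \<union> V1)" using x dom_V1_subset_scone by blast
  have nx: "norm x = 1" using dom_V1_norm[OF x] .
  have "(g has_derivative g1 x) (at (1 *\<^sub>R x))" using g1[of x] r by simp
  then have "((\<lambda>c. g (c *\<^sub>R x)) has_derivative (\<lambda>c. g1 x (c *\<^sub>R x))) (at 1)"
    by (intro has_derivative_compose[of "\<lambda>c. c *\<^sub>R x" "\<lambda>c. c *\<^sub>R x" 1 UNIV g "g1 x"])
       (auto intro!: derivative_eq_intros)
  moreover have "((\<lambda>c. g (c *\<^sub>R x)) has_derivative (\<lambda>c. 0)) (at 1)"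
  proof (rule has_derivative_transform_within[of "\<lambda>c. \<rho> x" _ _ _ "min r 1"])
    fix c :: real assume c: "dist c 1 < min r 1"
    then have "c > 0" by (auto simp: dist_real_def)
    have "norm (x - c *\<^sub>R x) = \<bar>1 - c\<bar>"
      using nx norm_scaleR[of "1 - c" x] by (simp add: scaleR_left_diff_distrib)
    then have "c *\<^sub>R x \<in> ball x r" using c by (auto simp: dist_norm dist_real_def)
    then have "g (c *\<^sub>R x) = hext \<rho> (c *\<^sub>R x)" using xs \<open>c > 0\<close> by (intro g) (simp_all add: scone_scaleR)
    then show "\<rho> x = g (c *\<^sub>R x)" using \<open>c > 0\<close> nx by (simp add: hext_scaleR) (simp add: hext_def)
  qed (use r in auto)
  ultimately have "g1 x (1 *\<^sub>R x) = 0" by (metis has_derivative_unique)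
  moreover have "Gr x \<bullet> x = g1 x x"
    using r x xs by (intro Gr_inner[of g] g1 fd) auto
  ultimately show ?thesis by simp
qed

text \<open>Links the two domains: \<open>Gr\<close> is defined within the cone over
  \<open>\<Omega> \<union> V1\<close>, while the assumptions on sigma use \<open>sgrad\<close> over
  \<Omega>. At points of \<Omega> both come from the ordinary derivative.\<close>

lemma hext_rho_derivative:
  assumes y: "y \<in> \<Omega>"
  shows "(hext \<rho> has_derivative (\<lambda>v. Gr y \<bullet> v)) (at y)"
proof -
  have x: "y \<in> \<Omega> \<union> V1" using y by simp
  obtain r g g1 g2 where r: "r > 0"
    and g1: "\<And>z. z \<in> ball y r \<Longrightarrow> (g has_derivative g1 z) (at z)"
    and g: "\<And>z. z \<in> ball y r \<Longrightarrow> z \<in> scone (\<Omega> \<union> V1) \<Longrightarrow> g z = hext \<rho> z"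
    and fd: "\<And>z t. z \<in> ball y r \<Longrightarrow> z \<in> scone (\<Omega> \<union> V1) \<Longrightarrow>
       frechet_derivative (hext (\<lambda>x. \<rho> x + t)) (at z within scone (\<Omega> \<union> V1)) = g1 z"
    by (rule local_C2_extension[OF x]) blast
  have "Gr y \<bullet> v = g1 y v" for v
    using r x dom_V1_subset_scone by (intro Gr_inner[of g] g1 fd) auto
  then have "g1 y = (\<lambda>v. Gr y \<bullet> v)" by auto
  then have "(g has_derivative (\<lambda>v. Gr y \<bullet> v)) (at y)" using g1[of y] r by simp
  then show ?thesis
  proof (rule has_derivative_transform_within_open[where s = "ball y r \<inter> scone \<Omega>"])
    show "y \<in> ball y r \<inter> scone \<Omega>" using y r sphere_subset_scone[OF dom_sub] by auto
    fix z assume "z \<in> ball y r \<inter> scone \<Omega>"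
    then show "g z = hext \<rho> z" by (intro g) (auto simp: scone_def)
  qed (use open_scone_dom in auto)
qed

section \<open>Lipschitz quantities built from \<open>s\<close>, the square of sigma\<close>

definition s :: "'a \<Rightarrow> real" where "s x = exp (- 2 * \<rho> x)"

lemma exp_sq: "(exp (- a))\<^sup>2 = exp (- 2 * (a::real))"
  by (simp flip: exp_double)

lemma hext_sq_derivative:
  assumes "y \<in> \<Omega>"
  shows "(hext (\<lambda>x. (exp (- \<rho> x))\<^sup>2) has_derivative (\<lambda>v. ((- 2 * s y) *\<^sub>R Gr y) \<bullet> v)) (at y)"
proof -
  have h: "hext \<rho> y = \<rho> y" using assms dom_sub by (auto simp: hext_def)
  have "((\<lambda>z. exp (- 2 * hext \<rho> z)) has_derivative (\<lambda>v. ((- 2 * s y) *\<^sub>R Gr y) \<bullet> v)) (at y)"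
    using hext_rho_derivative[OF assms]
    by (auto intro!: derivative_eq_intros simp: h s_def fun_eq_iff)
  moreover have "hext (\<lambda>x. (exp (- \<rho> x))\<^sup>2) = (\<lambda>z. exp (- 2 * hext \<rho> z))"
    by (simp add: hext_def fun_eq_iff exp_sq)
  ultimately show ?thesis by simp
qed

lemma hext_exp_derivative:
  assumes "y \<in> \<Omega>"
  shows "(hext (\<lambda>x. exp (- \<rho> x)) has_derivative (\<lambda>v. ((- exp (- \<rho> y)) *\<^sub>R Gr y) \<bullet> v)) (at y)"
proof -
  have h: "hext \<rho> y = \<rho> y" using assms dom_sub by (auto simp: hext_def)
  have "((\<lambda>z. exp (- hext \<rho> z)) has_derivative (\<lambda>v. ((- exp (- \<rho> y)) *\<^sub>R Gr y) \<bullet> v)) (at y)"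
    using hext_rho_derivative[OF assms]
    by (auto intro!: derivative_eq_intros simp: h fun_eq_iff)
  moreover have "hext (\<lambda>x. exp (- \<rho> x)) = (\<lambda>z. exp (- hext \<rho> z))"
    by (simp add: hext_def fun_eq_iff)
  ultimately show ?thesis by simp
qed

lemma sq_differentiable: "y \<in> \<Omega> \<Longrightarrow> hext (\<lambda>x. (exp (- \<rho> x))\<^sup>2) differentiable at y"
  using hext_sq_derivative by (auto simp: differentiable_def)

text \<open>Written through \<open>Gr\<close> so that \<open>Q\<close> and \<open>W\<close> are
  defined and continuous on \<open>V1\<close> too. On \<Omega> they are the expressions in sigma,
  because the gradient of sigma is \<open>- exp (- \<rho> x) *\<^sub>R Gr x\<close> and that of its
  square is \<open>(- 2 * s x) *\<^sub>R Gr x\<close>.\<close>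

definition Q :: "'a \<Rightarrow> real" where "Q x = s x * (1 + (norm (Gr x))\<^sup>2)"
definition W :: "'a \<Rightarrow> 'a" where "W x = (Q x - 2 * s x) *\<^sub>R x + (2 * s x) *\<^sub>R Gr x"

lemma lipschitz_on_dom_V1:
  fixes f :: "'a \<Rightarrow> 'b::metric_space"
  assumes "L-lipschitz_on \<Omega> f" "continuous_on (\<Omega> \<union> V1) f"
  shows "L-lipschitz_on (\<Omega> \<union> V1) f"
  using lipschitz_on_extend[OF assms(1) _ dom_V1_subset_closure assms(2)] by blast

lemma s_lipschitz: "\<exists>L. L-lipschitz_on \<Omega> s"
proof -
  obtain L where "L-lipschitz_on \<Omega> (\<lambda>x. (exp (- \<rho> x))\<^sup>2)"
    using c11_closure_lipschitz[OF sq_differentiable h1] by blast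
  then show ?thesis unfolding exp_sq s_def by blast
qed

lemma Q_lipschitz: "\<exists>L. L-lipschitz_on \<Omega> Q"
proof -
  obtain L where L: "L-lipschitz_on \<Omega> (\<lambda>x. (norm (sgrad (\<lambda>y. exp (- \<rho> y)) \<Omega> x))\<^sup>2)"
    using h2 by blast
  obtain L' where L': "L'-lipschitz_on \<Omega> s" using s_lipschitz by blast
  have "(L' + L)-lipschitz_on \<Omega> Q"
  proof (rule lipschitz_on_transform[OF lipschitz_on_add[OF L' L]])
    fix x assume "x \<in> \<Omega>"
    then have "sgrad (\<lambda>y. exp (- \<rho> y)) \<Omega> x = (- exp (- \<rho> x)) *\<^sub>R Gr x"
      using hext_exp_derivative by (intro sgrad_eqI)
    then show "Q x = s x + (norm (sgrad (\<lambda>y. exp (- \<rho> y)) \<Omega> x))\<^sup>2"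
      by (simp add: Q_def s_def power_mult_distrib exp_sq algebra_simps)
  qed
  then show ?thesis by blast
qed

lemma W_lipschitz: "\<exists>L. L-lipschitz_on \<Omega> W"
proof -
  obtain L where L: "L-lipschitz_on \<Omega> (sgrad (\<lambda>x. (exp (- \<rho> x))\<^sup>2) \<Omega>)"
    using h1 unfolding c11_closure_def by blast
  obtain Ls where Ls: "Ls-lipschitz_on \<Omega> s" using s_lipschitz by blast
  obtain Lq where Lq: "Lq-lipschitz_on \<Omega> Q" using Q_lipschitz by blast
  have "(Lq + 2 * Ls)-lipschitz_on \<Omega> (\<lambda>x. Q x + (- 2) * s x)"
    using lipschitz_on_add[OF Lq lipschitz_on_cmult_real[OF Ls, of "- 2"]] by simp
  from lipschitz_on_scaleR[OF this lipschitz_on_id bounded_dom]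
  obtain K where K: "K-lipschitz_on \<Omega> (\<lambda>x. (Q x + (- 2) * s x) *\<^sub>R x)" by blast
  have "(K + \<bar>- 1\<bar> * L)-lipschitz_on \<Omega> W"
  proof (rule lipschitz_on_transform[OF lipschitz_on_add[OF K lipschitz_on_cmult[OF L, of "- 1"]]])
    fix x assume "x \<in> \<Omega>"
    then have "sgrad (\<lambda>x. (exp (- \<rho> x))\<^sup>2) \<Omega> x = (- 2 * s x) *\<^sub>R Gr x"
      using hext_sq_derivative by (intro sgrad_eqI)
    then show "W x = (Q x + - 2 * s x) *\<^sub>R x + - 1 *\<^sub>R sgrad (\<lambda>x. (exp (- \<rho> x))\<^sup>2) \<Omega> x"
      by (simp add: W_def)
  qed
  then show ?thesis by blast
qed

text \<open>Continuity on \<open>\<Omega> \<union> V1\<close> extends the Lipschitz bounds from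
  \<Omega>, and a Lipschitz map is bounded on a bounded set. The bound on \<open>s\<close> follows
  from \<open>s x \<le> Q x\<close>.\<close>

lemma Q_W_bounds:
  obtains K where "K > 0" "K-lipschitz_on (\<Omega> \<union> V1) Q" "K-lipschitz_on (\<Omega> \<union> V1) W"
    "\<And>x. x \<in> \<Omega> \<union> V1 \<Longrightarrow> \<bar>Q x\<bar> \<le> K" "\<And>x. x \<in> \<Omega> \<union> V1 \<Longrightarrow> norm (W x) \<le> K"
    "\<And>x. x \<in> \<Omega> \<union> V1 \<Longrightarrow> s x \<le> K"
proof -
  have cs: "continuous_on (\<Omega> \<union> V1) s" unfolding s_def
    by (intro continuous_intros continuous_rho)
  have cQ: "continuous_on (\<Omega> \<union> V1) Q" unfolding Q_def
    by (intro continuous_intros cs continuous_Gr)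
  have cW: "continuous_on (\<Omega> \<union> V1) W" unfolding W_def
    by (intro continuous_intros cs cQ continuous_Gr)
  obtain Lq Lw where L: "Lq-lipschitz_on (\<Omega> \<union> V1) Q" "Lw-lipschitz_on (\<Omega> \<union> V1) W"
    using Q_lipschitz W_lipschitz lipschitz_on_dom_V1 cQ cW by meson
  have bd: "bounded (\<Omega> \<union> V1)" using dom_V1_subset_closure compact_closure bounded_subset compact_imp_bounded by blast
  obtain Bq where Bq: "\<And>x. x \<in> \<Omega> \<union> V1 \<Longrightarrow> norm (Q x) \<le> Bq"
    using lipschitz_on_imp_bounded[OF L(1) bd] unfolding bounded_iff by blast
  obtain Bw where Bw: "\<And>x. x \<in> \<Omega> \<union> V1 \<Longrightarrow> norm (W x) \<le> Bw"
    using lipschitz_on_imp_bounded[OF L(2) bd] unfolding bounded_iff by blast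
  define K where "K = 1 + \<bar>Bq\<bar> + \<bar>Bw\<bar> + Lq + Lw"
  have nn: "Lq \<ge> 0" "Lw \<ge> 0" using L lipschitz_on_nonneg by auto
  show ?thesis
  proof (rule that[of K])
    show "K-lipschitz_on (\<Omega> \<union> V1) Q" "K-lipschitz_on (\<Omega> \<union> V1) W"
      by (rule lipschitz_on_le[OF L(1)] lipschitz_on_le[OF L(2)], use nn in \<open>simp add: K_def\<close>)+
    show "K > 0" using nn by (simp add: K_def)
    fix x assume x: "x \<in> \<Omega> \<union> V1"
    show "\<bar>Q x\<bar> \<le> K" using Bq[OF x] nn by (simp add: K_def)
    moreover have "s x \<le> Q x" by (simp add: Q_def s_def)
    ultimately show "s x \<le> K" by linarith
    show "norm (W x) \<le> K" using Bw[OF x] nn by (simp add: K_def)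
  qed
qed

lemma schouten_bound:
  obtains C where "C > 0" "\<And>x u t. x \<in> \<Omega> \<union> V1 \<Longrightarrow>
    2 * s x * schouten (\<lambda>x. \<rho> x + t) (\<Omega> \<union> V1) x u u \<le> (s x + C) * (norm u)\<^sup>2"
proof -
  define f where "f = (\<lambda>x. (exp (- \<rho> x))\<^sup>2)"
  obtain C where C: "C > 0" "\<And>y z. y \<in> scone \<Omega> \<Longrightarrow> z \<in> scone \<Omega> \<Longrightarrow> norm y \<ge> 1/2 \<Longrightarrow> norm z \<ge> 1/2 \<Longrightarrow>
    norm (sgrad f \<Omega> (y /\<^sub>R norm y) /\<^sub>R norm y - sgrad f \<Omega> (z /\<^sub>R norm z) /\<^sub>R norm z) \<le> C * norm (y - z)"
    using scaled_sgrad_lipschitz[OF h1] unfolding f_def by blast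
  have "2 * s x * schouten (\<lambda>x. \<rho> x + t) (\<Omega> \<union> V1) x u u \<le> (s x + C) * (norm u)\<^sup>2"
    if x: "x \<in> \<Omega> \<union> V1" for x u t
  proof -
    obtain r g g1 g2 where r: "r > 0" "r \<le> 1/2"
      and g1: "\<And>y. y \<in> ball x r \<Longrightarrow> (g has_derivative g1 y) (at y)"
      and g2: "\<And>y u. y \<in> ball x r \<Longrightarrow> ((\<lambda>z. g1 z u) has_derivative g2 y u) (at y)"
      and cont: "\<And>u. isCont (\<lambda>y. g2 y u u) x"
      and g: "\<And>y. y \<in> ball x r \<Longrightarrow> y \<in> scone (\<Omega> \<union> V1) \<Longrightarrow> g y = hext \<rho> y"
      and fd: "\<And>y t. y \<in> ball x r \<Longrightarrow> y \<in> scone (\<Omega> \<union> V1) \<Longrightarrow>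
       frechet_derivative (hext (\<lambda>x. \<rho> x + t)) (at y within scone (\<Omega> \<union> V1)) = g1 y"
      by (rule local_C2_extension[OF x]) blast
    have nx: "norm x = 1" using dom_V1_norm[OF x] .
    have xs: "x \<in> scone (\<Omega> \<union> V1)" using x dom_V1_subset_scone by blast
    have xr: "x \<in> ball x r" using r by simp
    \<comment> \<open>This is the second derivative of \<open>exp (- 2 * g)\<close> in direction
      \<open>u\<close>, taken twice.\<close>
    define h where "h y = (4 * (g1 y u)\<^sup>2 - 2 * g2 y u u) * exp (- 2 * g y)" for y
    have K: "h y \<le> C * (norm u)\<^sup>2" if y: "y \<in> scone \<Omega> \<inter> ball x r" for y
    proof -
      define T where "T = scone \<Omega> \<inter> ball x r"
      \<comment> \<open>The first derivative of \<open>exp (- 2 * g)\<close> in direction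
        \<open>u\<close>. Over \<Omega> it is a component of the gradient of \<open>hext f\<close>,
        hence Lipschitz, which bounds \<open>P' u = h y\<close>.\<close>
      define P where "P z = - 2 * exp (- 2 * g z) * g1 z u" for z
      define P' where "P' v = (4 * g1 y v * g1 y u - 2 * g2 y u v) * exp (- 2 * g y)" for v
      have "(P has_derivative P') (at y)"
        unfolding P_def P'_def using y
        by (auto intro!: derivative_eq_intros g1 g2 simp: fun_eq_iff algebra_simps)
      have P: "P z = (sgrad f \<Omega> (z /\<^sub>R norm z) /\<^sub>R norm z) \<bullet> u" and nz: "norm z \<ge> 1/2" if z: "z \<in> T" for z
      proof -
        have zr: "z \<in> ball x r" "z \<in> scone \<Omega>" using z by (auto simp: T_def)
        have "norm (x - z) < 1/2" using zr r by (simp add: dist_norm)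
        then show "norm z \<ge> 1/2" using norm_triangle_ineq2[of x z] nx by linarith
        have "((\<lambda>z. exp (- 2 * g z)) has_derivative (\<lambda>v. - 2 * exp (- 2 * g z) * g1 z v)) (at z)"
          using g1[OF zr(1)] by (auto intro!: derivative_eq_intros simp: fun_eq_iff)
        then have "(hext f has_derivative (\<lambda>v. - 2 * exp (- 2 * g z) * g1 z v)) (at z)"
        proof (rule has_derivative_transform_within_open[where s = T])
          show "open T" using open_scone_dom by (auto simp: T_def)
          fix w assume "w \<in> T"
          then have "g w = hext \<rho> w" by (intro g) (auto simp: T_def scone_def)
          then show "exp (- 2 * g w) = hext f w" by (simp add: hext_def f_def exp_sq)
        qed (rule z)
        moreover have "(hext f has_derivative (\<lambda>v. (sgrad f \<Omega> (z /\<^sub>R norm z) /\<^sub>R norm z) \<bullet> v)) (at z)"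
          using sq_differentiable zr(2) unfolding f_def by (rule has_derivative_hext)
        ultimately have "(\<lambda>v. - 2 * exp (- 2 * g z) * g1 z v) = (\<lambda>v. (sgrad f \<Omega> (z /\<^sub>R norm z) /\<^sub>R norm z) \<bullet> v)"
          by (rule has_derivative_unique)
        then show "P z = (sgrad f \<Omega> (z /\<^sub>R norm z) /\<^sub>R norm z) \<bullet> u"
          unfolding P_def by metis
      qed
      have "norm (P' u) \<le> (C * norm u) * norm u"
      proof (rule lipschitz_derivative_bound[OF \<open>(P has_derivative P') (at y)\<close>])
        show "open T" "y \<in> T" using open_scone_dom y by (auto simp: T_def)
        fix z assume z: "z \<in> T"
        have "P z - P y = (sgrad f \<Omega> (z /\<^sub>R norm z) /\<^sub>R norm z - sgrad f \<Omega> (y /\<^sub>R norm y) /\<^sub>R norm y) \<bullet> u"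
          using P[OF z] P[OF \<open>y \<in> T\<close>] by (simp only: inner_diff_left)
        also have "norm \<dots> \<le> norm (sgrad f \<Omega> (z /\<^sub>R norm z) /\<^sub>R norm z - sgrad f \<Omega> (y /\<^sub>R norm y) /\<^sub>R norm y) * norm u"
          unfolding real_norm_def by (rule Cauchy_Schwarz_ineq2)
        also have "\<dots> \<le> (C * norm (z - y)) * norm u"
          using z nz[OF z] nz[OF \<open>y \<in> T\<close>] y by (intro mult_right_mono C(2)) (auto simp: T_def)
        finally show "norm (P z - P y) \<le> C * norm u * norm (z - y)" by (simp add: mult_ac)
      qed
      moreover have "h y = P' u" by (simp add: h_def P'_def power2_eq_square)
      ultimately show ?thesis by (simp add: power2_eq_square abs_le_iff)
    qed
    have "isCont h x"
      unfolding h_def using has_derivative_continuous[OF g1[OF xr]] has_derivative_continuous[OF g2[OF xr]]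
      by (intro continuous_intros cont)
    \<comment> \<open>The bound was obtained over \<Omega>; since \<open>x\<close> may lie on
      \<open>V1\<close>, it is carried over by continuity of \<open>h\<close> and density.\<close>
    have hx: "h x \<le> C * (norm u)\<^sup>2"
    proof (rule ccontr)
      assume "\<not> ?thesis"
      then have "\<forall>\<^sub>F y in nhds x. C * (norm u)\<^sup>2 < h y"
        using \<open>isCont h x\<close> by (intro order_tendstoD(1)[of h "h x"]) (auto simp: isCont_def tendsto_at_iff_tendsto_nhds)
      then obtain d where d: "d > 0" "\<And>y. dist y x < d \<Longrightarrow> C * (norm u)\<^sup>2 < h y"
        unfolding eventually_nhds_metric by blast
      have "x \<in> closure (scone \<Omega>)"
        using x dom_V1_subset_closure closure_mono[OF sphere_subset_scone[OF dom_sub]] by blast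
      then obtain y where "y \<in> scone \<Omega>" "dist y x < min d r"
        using d(1) r(1) unfolding closure_approachable by (metis min_less_iff_conj)
      then show False using K[of y] d(2)[of y] by (auto simp: dist_commute)
    qed
    have sh: "shess (\<lambda>x. \<rho> x + t) (\<Omega> \<union> V1) x u u = g2 x u u"
    proof -
      have "((\<lambda>y. frechet_derivative (hext (\<lambda>x. \<rho> x + t)) (at y within scone (\<Omega> \<union> V1)) u)
              has_derivative g2 x u) (at x within scone (\<Omega> \<union> V1))"
        by (rule has_derivative_transform_within[OF has_derivative_at_withinI[OF g2[OF xr, of u]] r(1) xs])
           (auto simp: fd dist_commute)
      from frechet_derivative_eq[OF xs this] show ?thesis by (simp add: shess_def)
    qed
    have gu: "Gr x \<bullet> u = g1 x u" using x xs xr by (intro Gr_inner[of g] g1 fd) auto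
    have gx: "exp (- 2 * g x) = s x" using g[OF xr xs] nx by (simp add: s_def hext_def)
    have "2 * s x * schouten (\<lambda>x. \<rho> x + t) (\<Omega> \<union> V1) x u u
       = s x * (norm u)\<^sup>2 + h x - 2 * s x * (g1 x u)\<^sup>2 - s x * (norm (Gr x))\<^sup>2 * (norm u)\<^sup>2"
      unfolding schouten_def sh sgrad_shift[OF x] gu h_def gx
      by (simp add: algebra_simps power2_eq_square flip: power2_norm_eq_inner)
    also have "\<dots> \<le> s x * (norm u)\<^sup>2 + h x"
    proof -
      have "0 \<le> s x * (g1 x u)\<^sup>2" "0 \<le> s x * (norm (Gr x))\<^sup>2 * (norm u)\<^sup>2" by (auto simp: s_def)
      then show ?thesis by linarith
    qed
    finally show ?thesis using hx by (simp add: algebra_simps)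
  qed
  then show ?thesis using that C(1) by blast
qed

section \<open>The hypersurface: position, injectivity and concavity\<close>

lemma phi_hyperbolic:
  assumes x: "x \<in> \<Omega> \<union> V1"
  shows "phi (\<lambda>x. \<rho> x + t) (\<Omega> \<union> V1) x \<in> hyperbolic_space"
proof -
  define e where "e = exp (- (\<rho> x + t))"
  define p where "p = (norm (Gr x))\<^sup>2"
  define c where "c = (1 + e\<^sup>2 * (1 + p)) / (2 * e)"
  have e: "e > 0" by (simp add: e_def)
  have p: "p \<ge> 0" by (simp add: p_def)
  have ex: "exp (\<rho> x + t) = 1 / e" "exp (- 2 * (\<rho> x + t)) = e\<^sup>2"
    unfolding e_def exp_sq by (metis exp_minus inverse_eq_divide minus_minus) simp
  have ph: "phi (\<lambda>x. \<rho> x + t) (\<Omega> \<union> V1) x = (c, c *\<^sub>R x + e *\<^sub>R (Gr x - x))"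
    unfolding phi_def sgrad_shift[OF x] ex Let_def c_def p_def e_def[symmetric] by simp
  have xx: "x \<bullet> x = 1" using dom_V1_norm[OF x] by (simp add: dot_square_norm)
  have "c > 0" unfolding c_def using e p by (intro divide_pos_pos add_pos_nonneg) auto
  \<comment> \<open>The first coordinate \<open>c\<close> is exactly the value for which the Lorentz
    square of the point equals -1.\<close>
  have ce: "2 * c * e = 1 + e\<^sup>2 * (1 + p)" using e by (simp add: c_def)
  have "Gr x \<bullet> Gr x = p" by (simp add: p_def power2_norm_eq_inner)
  then have "(c *\<^sub>R x + e *\<^sub>R (Gr x - x)) \<bullet> (c *\<^sub>R x + e *\<^sub>R (Gr x - x)) = c\<^sup>2 - 2 * c * e + e\<^sup>2 * (1 + p)"
    using xx Gr_tangent[OF x] inner_commute[of x "Gr x"]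
    by (simp add: inner_add_left inner_add_right inner_diff_left inner_diff_right power2_eq_square algebra_simps)
  then show ?thesis using ce \<open>c > 0\<close> by (simp add: ph hyperbolic_space_def)
qed

text \<open>Multiplying by \<open>k\<close> removes the growth of the leading factor
  \<open>exp (\<rho> x + t) / 2\<close>, and the remaining terms carry the factor
  \<open>exp (- 2 * (\<rho> x + t))\<close>, which is \<open>\<epsilon> * s x\<close>.\<close>

lemma phi_projective:
  fixes t :: real
  assumes x: "x \<in> \<Omega> \<union> V1"
  defines "k \<equiv> 2 * exp (- (\<rho> x + t))" and "\<epsilon> \<equiv> exp (- 2 * t)"
  shows "k * fst (phi (\<lambda>x. \<rho> x + t) (\<Omega> \<union> V1) x) = 1 + \<epsilon> * Q x"
    "k *\<^sub>R snd (phi (\<lambda>x. \<rho> x + t) (\<Omega> \<union> V1) x) = x + \<epsilon> *\<^sub>R W x"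
proof -
  define e where "e = exp (- (\<rho> x + t))"
  have ex: "exp (\<rho> x + t) = 1 / e" "exp (- 2 * (\<rho> x + t)) = \<epsilon> * s x"
    unfolding e_def
    by (metis exp_minus inverse_eq_divide minus_minus)
       (simp add: \<epsilon>_def s_def algebra_simps flip: exp_add)
  have ee: "e * e = \<epsilon> * s x" using ex(2) exp_sq[of "\<rho> x + t"] by (simp add: e_def power2_eq_square)
  have e0: "e \<noteq> 0" by (simp add: e_def)
  define c where "c = 1 / e / 2 * (1 + \<epsilon> * s x * (1 + (norm (Gr x))\<^sup>2))"
  have kc: "2 * e * c = 1 + \<epsilon> * Q x" using e0 by (simp add: c_def Q_def)
  have ph: "phi (\<lambda>x. \<rho> x + t) (\<Omega> \<union> V1) x = (c, c *\<^sub>R x + e *\<^sub>R (Gr x - x))"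
    unfolding phi_def sgrad_shift[OF x] ex Let_def c_def e_def[symmetric] ..
  show "k * fst (phi (\<lambda>x. \<rho> x + t) (\<Omega> \<union> V1) x) = 1 + \<epsilon> * Q x"
    using kc unfolding k_def e_def[symmetric] by (simp add: ph)
  have "k *\<^sub>R snd (phi (\<lambda>x. \<rho> x + t) (\<Omega> \<union> V1) x) = (2 * e * c) *\<^sub>R x + (2 * (e * e)) *\<^sub>R (Gr x - x)"
    unfolding k_def e_def[symmetric] by (simp add: ph scaleR_add_right mult.assoc)
  also have "\<dots> = x + \<epsilon> *\<^sub>R W x"
    unfolding kc ee W_def by (simp add: algebra_simps)
  finally show "k *\<^sub>R snd (phi (\<lambda>x. \<rho> x + t) (\<Omega> \<union> V1) x) = x + \<epsilon> *\<^sub>R W x" .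
qed

text \<open>Equal images force \<open>x - y\<close> to equal \<epsilon> times differences of
  Lipschitz quantities, so its norm is at most a factor below 1 times itself.\<close>

lemma phi_inj:
  assumes K: "K > 0" "K-lipschitz_on (\<Omega> \<union> V1) Q" "K-lipschitz_on (\<Omega> \<union> V1) W"
    "\<And>x. x \<in> \<Omega> \<union> V1 \<Longrightarrow> \<bar>Q x\<bar> \<le> K" "\<And>x. x \<in> \<Omega> \<union> V1 \<Longrightarrow> norm (W x) \<le> K"
    and t: "exp (2 * t) > 1 + 3 * K + 2 * K\<^sup>2"
  shows "inj_on (phi (\<lambda>x. \<rho> x + t) (\<Omega> \<union> V1)) (\<Omega> \<union> V1)"
proof (rule inj_onI)
  fix x y assume x: "x \<in> \<Omega> \<union> V1" and y: "y \<in> \<Omega> \<union> V1"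
    and eq: "phi (\<lambda>x. \<rho> x + t) (\<Omega> \<union> V1) x = phi (\<lambda>x. \<rho> x + t) (\<Omega> \<union> V1) y"
  define \<epsilon> where "\<epsilon> = exp (- 2 * t)"
  define c where "c = fst (phi (\<lambda>x. \<rho> x + t) (\<Omega> \<union> V1) x)"
  define v where "v = snd (phi (\<lambda>x. \<rho> x + t) (\<Omega> \<union> V1) x)"
  note px = phi_projective[OF x, of t, folded \<epsilon>_def c_def v_def]
    and py = phi_projective[OF y, of t, folded \<epsilon>_def, folded eq, folded c_def v_def]
  have pos: "\<epsilon> > 0" by (simp add: \<epsilon>_def)
  have te: "\<epsilon> * exp (2 * t) = 1" by (simp add: \<epsilon>_def flip: exp_add)
  \<comment> \<open>The summand 1 in the threshold yields \<open>\<epsilon> < 1\<close>, used to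
    absorb the second-order terms; the rest yields the contraction factor
    \<open>\<epsilon> * (3 * K + 2 * K\<^sup>2) < 1\<close>.\<close>
  then have e1: "\<epsilon> * (1 + 3 * K + 2 * K\<^sup>2) < 1" using mult_strict_left_mono[OF t pos] by simp
  have "\<epsilon> \<le> \<epsilon> * (1 + 3 * K + 2 * K\<^sup>2)" using pos K(1) by (intro mult_le_cancel_left1[THEN iffD2]) auto
  then have e2: "\<epsilon> < 1" using e1 by linarith
  \<comment> \<open>The multipliers \<open>k\<close> at \<open>x\<close> and at \<open>y\<close> may
    differ; cross-multiplying the projective coordinates makes both sides the same product of the
    two multipliers with \<open>c\<close> and \<open>v\<close>.\<close>
  have "(1 + \<epsilon> * Q y) *\<^sub>R (x + \<epsilon> *\<^sub>R W x) = (1 + \<epsilon> * Q x) *\<^sub>R (y + \<epsilon> *\<^sub>R W y)"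
    unfolding px[symmetric] py[symmetric] by (simp add: mult_ac)
  then have xy: "x - y = \<epsilon> *\<^sub>R ((W y - W x) + (Q x - Q y) *\<^sub>R y + Q y *\<^sub>R (y - x))
     + (\<epsilon> * \<epsilon>) *\<^sub>R ((Q x - Q y) *\<^sub>R W y + Q y *\<^sub>R (W y - W x))"
    by (simp add: algebra_simps)
  have "norm (x - y) \<le> norm (\<epsilon> *\<^sub>R ((W y - W x) + (Q x - Q y) *\<^sub>R y + Q y *\<^sub>R (y - x)))
     + norm ((\<epsilon> * \<epsilon>) *\<^sub>R ((Q x - Q y) *\<^sub>R W y + Q y *\<^sub>R (W y - W x)))"
    unfolding xy by (rule norm_triangle_ineq)
  also have "\<dots> \<le> \<epsilon> * (3 * K * norm (x - y)) + \<epsilon> * (2 * K\<^sup>2 * norm (x - y))"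
  proof (rule add_mono)
    have w: "norm (W y - W x) \<le> K * norm (x - y)"
      using lipschitz_on_normD[OF K(3) y x] by (simp add: norm_minus_commute)
    have q: "\<bar>Q x - Q y\<bar> \<le> K * norm (x - y)"
      using lipschitz_on_normD[OF K(2) x y] by simp
    have "norm ((W y - W x) + (Q x - Q y) *\<^sub>R y + Q y *\<^sub>R (y - x))
      \<le> norm (W y - W x) + norm ((Q x - Q y) *\<^sub>R y) + norm (Q y *\<^sub>R (y - x))"
      by (meson add_right_mono norm_triangle_ineq order_trans)
    also have "\<dots> \<le> K * norm (x - y) + K * norm (x - y) + K * norm (x - y)"
      using w q dom_V1_norm[OF y] mult_right_mono[OF K(4)[OF y], of "norm (x - y)"]
      by (simp add: norm_minus_commute[of y x])
    finally show "norm (\<epsilon> *\<^sub>R ((W y - W x) + (Q x - Q y) *\<^sub>R y + Q y *\<^sub>R (y - x))) \<le> \<epsilon> * (3 * K * norm (x - y))"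
      using pos by simp
    have "norm ((Q x - Q y) *\<^sub>R W y + Q y *\<^sub>R (W y - W x)) \<le> \<bar>Q x - Q y\<bar> * norm (W y) + \<bar>Q y\<bar> * norm (W y - W x)"
      by (rule order_trans[OF norm_triangle_ineq]) simp
    also have "\<dots> \<le> (K * norm (x - y)) * K + K * (K * norm (x - y))"
      using K q w x y by (intro add_mono mult_mono) auto
    also have "\<dots> = 2 * K\<^sup>2 * norm (x - y)" by (simp add: power2_eq_square)
    finally have "(\<epsilon> * \<epsilon>) * norm ((Q x - Q y) *\<^sub>R W y + Q y *\<^sub>R (W y - W x)) \<le> \<epsilon> * (2 * K\<^sup>2 * norm (x - y))"
      using pos e2 by (intro mult_mono) (auto simp: mult_left_le_one_le)
    then show "norm ((\<epsilon> * \<epsilon>) *\<^sub>R ((Q x - Q y) *\<^sub>R W y + Q y *\<^sub>R (W y - W x))) \<le> \<epsilon> * (2 * K\<^sup>2 * norm (x - y))"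
      using pos by simp
  qed
  also have "\<dots> = (\<epsilon> * (3 * K + 2 * K\<^sup>2)) * norm (x - y)" by (simp add: algebra_simps)
  finally have "(1 - \<epsilon> * (3 * K + 2 * K\<^sup>2)) * norm (x - y) \<le> 0" by (simp add: algebra_simps)
  moreover have "1 - \<epsilon> * (3 * K + 2 * K\<^sup>2) > 0" using e1 pos by (simp add: algebra_simps)
  ultimately show "x = y" by (simp add: mult_le_0_iff)
qed

text \<open>Testing the eigenvalue equation on the eigenvector itself leaves only the quadratic
  form, and \<open>s x\<close> cancels the conformal factor down to
  \<open>exp (2 * t)\<close>.\<close>

lemma horo_concave_shift:
  assumes C: "\<And>x u. x \<in> \<Omega> \<union> V1 \<Longrightarrow>
    2 * s x * schouten (\<lambda>x. \<rho> x + t) (\<Omega> \<union> V1) x u u \<le> (s x + C) * (norm u)\<^sup>2"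
    and K: "\<And>x. x \<in> \<Omega> \<union> V1 \<Longrightarrow> s x \<le> K" and t: "exp (2 * t) > K + C"
  shows "horo_concave (\<lambda>x. \<rho> x + t) (\<Omega> \<union> V1)"
  unfolding horo_concave_def
proof (intro ballI)
  fix x lam assume x: "x \<in> \<Omega> \<union> V1" and "lam \<in> schouten_eigenvalues (\<lambda>x. \<rho> x + t) (\<Omega> \<union> V1) x"
  then obtain u where u: "u \<bullet> x = 0" "u \<noteq> 0"
    "schouten (\<lambda>x. \<rho> x + t) (\<Omega> \<union> V1) x u u = lam * (exp (2 * (\<rho> x + t)) * (u \<bullet> u))"
    unfolding schouten_eigenvalues_def by blast
  have "s x * exp (2 * (\<rho> x + t)) = exp (2 * t)" by (simp add: s_def algebra_simps flip: exp_add)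
  then have "2 * s x * (lam * (exp (2 * (\<rho> x + t)) * (u \<bullet> u))) = 2 * lam * exp (2 * t) * (norm u)\<^sup>2"
    by (simp add: power2_norm_eq_inner algebra_simps)
  then have "2 * lam * exp (2 * t) * (norm u)\<^sup>2 \<le> (s x + C) * (norm u)\<^sup>2"
    using C[OF x, of u] unfolding u(3) by metis
  then have "2 * lam * exp (2 * t) \<le> s x + C" using u(2) by simp
  also have "\<dots> < exp (2 * t)" using K[OF x] t by linarith
  finally show "lam < 1 / 2" by simp
qed

end

theorem mainTheorem5:
  fixes \<Omega> V1 V2 :: "'a::euclidean_space set" and \<rho> :: "'a \<Rightarrow> real" and \<alpha> :: real
  assumes dim: "DIM('a) \<ge> 4"
    and dom_sub: "\<Omega> \<subseteq> sphere 0 1"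
    and dom_open: "openin (top_of_set (sphere 0 1)) \<Omega>"
    and dom_conn: "connected \<Omega>" and dom_ne: "\<Omega> \<noteq> {}"
    and bdry: "closure \<Omega> - \<Omega> = V1 \<union> V2"
    and disj: "V1 \<inter> V2 = {}"
    and V1: "compact_submanifold_of_sphere V1"
    and V2: "compact_submanifold_of_sphere V2"
    and alpha: "0 < \<alpha>" "\<alpha> < 1"
    and reg: "c2alpha_on \<alpha> (\<Omega> \<union> V1) \<rho>"
    and h1: "c11_closure \<Omega> (\<lambda>x. (exp (- \<rho> x))\<^sup>2)"
    and h2: "\<exists>L. L-lipschitz_on \<Omega> (\<lambda>x. (norm (sgrad (\<lambda>y. exp (- \<rho> y)) \<Omega> x))\<^sup>2)"
  shows "\<exists>t0>0. \<forall>t>t0.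
           phi (\<lambda>x. \<rho> x + t) (\<Omega> \<union> V1) ` (\<Omega> \<union> V1) \<subseteq> hyperbolic_space \<and>
           horo_concave (\<lambda>x. \<rho> x + t) (\<Omega> \<union> V1) \<and>
           inj_on (phi (\<lambda>x. \<rho> x + t) (\<Omega> \<union> V1)) (\<Omega> \<union> V1)"
proof -
  interpret horospherical_data \<Omega> V1 V2 \<rho> \<alpha>
    by unfold_locales (fact assms)+
  obtain K where K: "K > 0" "K-lipschitz_on (\<Omega> \<union> V1) Q" "K-lipschitz_on (\<Omega> \<union> V1) W"
    "\<And>x. x \<in> \<Omega> \<union> V1 \<Longrightarrow> \<bar>Q x\<bar> \<le> K" "\<And>x. x \<in> \<Omega> \<union> V1 \<Longrightarrow> norm (W x) \<le> K"
    "\<And>x. x \<in> \<Omega> \<union> V1 \<Longrightarrow> s x \<le> K"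
    using Q_W_bounds by blast
  obtain C where C: "C > 0" "\<And>x u t. x \<in> \<Omega> \<union> V1 \<Longrightarrow>
    2 * s x * schouten (\<lambda>x. \<rho> x + t) (\<Omega> \<union> V1) x u u \<le> (s x + C) * (norm u)\<^sup>2"
    using schouten_bound by blast
  \<comment> \<open>Large enough for both thresholds at once, the one for injectivity and
    \<open>K + C\<close> for concavity, using \<open>exp (2 * t) \<ge> 1 + 2 * t\<close>.\<close>
  define t0 where "t0 = 1 + 3 * K + 2 * K\<^sup>2 + C"
  show ?thesis
  proof (intro exI[of _ t0] conjI allI impI)
    have k2: "K\<^sup>2 \<ge> 0" by simp
    show "t0 > 0" unfolding t0_def using K(1) C(1) k2 by linarith
    fix t assume "t > t0"
    moreover have "exp (2 * t) \<ge> 1 + 2 * t" by (rule exp_ge_add_one_self)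
    ultimately have t: "exp (2 * t) > 1 + 3 * K + 2 * K\<^sup>2" "exp (2 * t) > K + C"
      unfolding t0_def using K(1) C(1) k2 by linarith+
    show "phi (\<lambda>x. \<rho> x + t) (\<Omega> \<union> V1) ` (\<Omega> \<union> V1) \<subseteq> hyperbolic_space"
      using phi_hyperbolic by blast
    show "horo_concave (\<lambda>x. \<rho> x + t) (\<Omega> \<union> V1)"
      using C(2) K(6) t(2) by (rule horo_concave_shift)
    show "inj_on (phi (\<lambda>x. \<rho> x + t) (\<Omega> \<union> V1)) (\<Omega> \<union> V1)"
      using K(1-5) t(1) by (rule phi_inj)
  qed
qed

end
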